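(* Let $L>0$ and $e\in\mathbb{S}^{N-1}$ be fixed. Assume that the equation $$u_t=\nabla\cdot(A(x/L)\nabla u)+B(x/L)\cdot\nabla u+f(x/L,u),\qquad t\in\mathbb{R},\ x\in\mathbb{R}^N,$$ admits a pulsating wave $U_{L,e}(t,x)=\phi_{L,e}(x\cdot e-c_{L,e}t,x/L)$ connecting $0$ and $1$ in the direction $e$ such that $(\phi_{L,e},c_{L,e})$ is a classical solution ($\phi_{L,e}\in C^2(\mathbb{R}\times\mathbb{T}^N)$) of $$\tilde\nabla_{L,e}\cdot(A(y)\tilde\nabla_{L,e}\phi_{L,e})+B(y)\cdot\tilde\nabla_{L,e}\phi_{L,e}+c_{L,e}\partial_\xi\phi_{L,e}+f(y,\phi_{L,e})=0,\quad(\xi,y)\in\mathbb{R}\times\mathbb{T}^N,$$ where $\tilde\nabla_{L,e}=e\,\partial_\xi+\frac1L\nabla_y$. Assume that $\tilde U_{L,e}(t,x)=\tilde\phi_{L,e}(x\cdot e-\tilde c_{L,e}t,x/L)$ is another pulsating wave of the same equation connecting $0$ and $1$ in the direction $e$. Then $\tilde c_{L,e}=c_{L,e}$. Furthermore: (i) if $c_{L,e}\neq0$, then there is $\tau_0\in\mathbb{R}$ such that $\tilde\phi_{L,e}(\xi,y)=\phi_{L,e}(\xi+\tau_0,y)$ for all $(\xi,y)\in\mathbb{R}\times\mathbb{T}^N$; (ii) if $c_{L,e}=0$ and $\tilde\phi_{L,e}\in C(\mathbb{R}\times\mathbb{T}^N)$, then there is $\tau_0\in\mathbb{R}$ such that $\tilde\phi_{L,e}(x\cdot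 e,x/L)=\phi_{L,e}(x\cdot e+\tau_0,x/L)$ for all $x\in\mathbb{R}^N$.
   Context: Let $N\ge1$ be an integer and $\mathbb{T}^N=\mathbb{R}^N/\mathbb{Z}^N$. The matrix field $A=(A_{ij}):\mathbb{R}^N\to\mathcal{M}_N$ (real $N\times N$ matrices, not assumed symmetric) is $\mathbb{Z}^N$-periodic, of class $C^2$, and there is $\eta_0>0$ with $\sum_{i,j}A_{ij}(x)\xi_i\xi_j\ge\eta_0|\xi|^2$ for all $x,\xi\in\mathbb{R}^N$. The vector field $B:\mathbb{R}^N\to\mathbb{R}^N$ is $\mathbb{Z}^N$-periodic of class $C^1$. The function $f:\mathbb{R}^N\times[0,1]\to\mathbb{R}$, $(x,u)\mapsto f(x,u)$, is of class $C^3$, $\mathbb{Z}^N$-periodic in $x$, satisfies $f(x,0)=f(x,1)=0$ for all $x$, and there are $\gamma_0>0$, $\delta_0\in(0,1/2)$ with $\partial_uf(x,u)\le-\gamma_0$ for all $x\in\mathbb{R}^N$, $u\in[0,\delta_0]\cup[1-\delta_0,1]$. Pulsating wave: for $L>0$ and $e\in\mathbb{S}^{N-1}$, a pair $(\phi,c)$ with $\phi:\mathbb{R}\times\mathbb{R}^N\to(0,1)$ and $c\in\mathbb{R}$ (or the function $U$ below) is a pulsating wave in the direction $e$ connecting $0$ and $1$ with speed $c$ if (a) $U(t,x)=\phi(x\cdot e-ct,x/L)$ is an entire classical solution of $u_t=\nabla\cdot(A(x/L)\nabla u)+B(x/L)\cdot\nabla u+f(x/L,u)$ on $\mathbb{R}\times\mathbb{R}^N$;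 (b) $\phi(\xi,y)$ is $\mathbb{Z}^N$-periodic in $y$, and $\lim_{\xi\to-\infty}\phi(\xi,y)=1$, $\lim_{\xi\to+\infty}\phi(\xi,y)=0$ uniformly in $y\in\mathbb{R}^N$. No regularity of $\phi$ itself beyond (a), (b) is part of this definition. *)

theory Defs
  imports "HOL-Analysis.Analysis"
begin

text \<open>
  Class \<open>C\<^sup>k\<close> on \<open>S\<close>. Derivatives are taken within \<open>S\<close>, so on a set such as
  \<open>UNIV \<times> {0..1}\<close> they are one-sided at boundary points and continuous up to the boundary.
  For such convex sets with nonempty interior, and for open sets, \<open>D\<close> is unique on \<open>S\<close>.
\<close>

primrec Ck_on :: "nat \<Rightarrow> 'a::euclidean_space set \<Rightarrow> ('a \<Rightarrow> 'b::real_normed_vector) \<Rightarrow> bool" where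
  "Ck_on 0 S g \<longleftrightarrow> continuous_on S g"
| "Ck_on (Suc k) S g \<longleftrightarrow>
     (\<exists>D. (\<forall>x\<in>S. (g has_derivative D x) (at x within S)) \<and>
          (\<forall>b\<in>Basis. Ck_on k S (\<lambda>x. D x b)))"

text \<open>Functions on the torus are represented by periodic functions on the whole space.\<close>

definition periodic_ZN :: "(real^'n \<Rightarrow> 'b) \<Rightarrow> bool" where
  "periodic_ZN g \<longleftrightarrow> (\<forall>x k. (\<forall>i. k $ i \<in> \<int>) \<longrightarrow> g (x + k) = g x)"

definition partial_deriv :: "'n \<Rightarrow> (real^'n \<Rightarrow> real) \<Rightarrow> real^'n \<Rightarrow> real" where
  "partial_deriv i g x = deriv (\<lambda>s. g (x + s *\<^sub>R axis i 1)) 0"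

definition grad :: "(real^'n \<Rightarrow> real) \<Rightarrow> real^'n \<Rightarrow> real^'n" where
  "grad g x = (\<chi> i. partial_deriv i g x)"

definition divergence :: "(real^'n \<Rightarrow> real^'n) \<Rightarrow> real^'n \<Rightarrow> real" where
  "divergence F x = (\<Sum>i\<in>UNIV. partial_deriv i (\<lambda>z. F z $ i) x)"

text \<open>
  Class \<open>C\<^sup>1\<close> in time and \<open>C\<^sup>2\<close> in space, all derivatives being jointly continuous.
\<close>

definition C12 :: "(real \<Rightarrow> real^'n \<Rightarrow> real) \<Rightarrow> bool" where
  "C12 u \<longleftrightarrow>
     continuous_on UNIV (\<lambda>(t, x). u t x) \<and>
     (\<forall>t x. (\<lambda>s. u s x) differentiable at t) \<and>
     continuous_on UNIV (\<lambda>(t, x). deriv (\<lambda>s. u s x) t) \<and>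
     (\<forall>t x. u t differentiable at x) \<and>
     (\<forall>i. continuous_on UNIV (\<lambda>(t, x). partial_deriv i (u t) x)) \<and>
     (\<forall>i t x. partial_deriv i (u t) differentiable at x) \<and>
     (\<forall>i j. continuous_on UNIV (\<lambda>(t, x). partial_deriv j (partial_deriv i (u t)) x))"

definition entire_classical_solution ::
  "(real^'n \<Rightarrow> real^'n^'n) \<Rightarrow> (real^'n \<Rightarrow> real^'n) \<Rightarrow> (real^'n \<Rightarrow> real \<Rightarrow> real) \<Rightarrow> real \<Rightarrow>
   (real \<Rightarrow> real^'n \<Rightarrow> real) \<Rightarrow> bool" where
  "entire_classical_solution A B f L u \<longleftrightarrow>
     C12 u \<and>
     (\<forall>t x. deriv (\<lambda>s. u s x) t =
        divergence (\<lambda>z. A (z /\<^sub>R L) *v grad (u t) z) x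
        + B (x /\<^sub>R L) \<bullet> grad (u t) x
        + f (x /\<^sub>R L) (u t x))"

definition pulsating_wave ::
  "(real^'n \<Rightarrow> real^'n^'n) \<Rightarrow> (real^'n \<Rightarrow> real^'n) \<Rightarrow> (real^'n \<Rightarrow> real \<Rightarrow> real) \<Rightarrow> real \<Rightarrow> real^'n \<Rightarrow>
   (real \<Rightarrow> real^'n \<Rightarrow> real) \<Rightarrow> real \<Rightarrow> bool" where
  "pulsating_wave A B f L e \<phi> c \<longleftrightarrow>
     (\<forall>\<xi> y. 0 < \<phi> \<xi> y \<and> \<phi> \<xi> y < 1) \<and>
     entire_classical_solution A B f L (\<lambda>t x. \<phi> (x \<bullet> e - c * t) (x /\<^sub>R L)) \<and>
     (\<forall>\<xi>. periodic_ZN (\<phi> \<xi>)) \<and>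
     uniform_limit UNIV \<phi> (\<lambda>_. 1) at_bot \<and>
     uniform_limit UNIV \<phi> (\<lambda>_. 0) at_top"

text \<open>
  The operator \<open>e \<partial>\<^sub>\<xi> + (1/L) \<nabla>\<^sub>y\<close>, given by its components, with the gradient and the
  divergence built from it.
\<close>

definition twisted_partial ::
  "real \<Rightarrow> real^'n \<Rightarrow> 'n \<Rightarrow> (real \<Rightarrow> real^'n \<Rightarrow> real) \<Rightarrow> real \<Rightarrow> real^'n \<Rightarrow> real" where
  "twisted_partial L e i g \<xi> y =
     e $ i * deriv (\<lambda>s. g s y) \<xi> + (1 / L) * partial_deriv i (g \<xi>) y"

definition twisted_grad ::
  "real \<Rightarrow> real^'n \<Rightarrow> (real \<Rightarrow> real^'n \<Rightarrow> real) \<Rightarrow> real \<Rightarrow> real^'n \<Rightarrow> real^'n" where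
  "twisted_grad L e g \<xi> y = (\<chi> i. twisted_partial L e i g \<xi> y)"

definition twisted_div ::
  "real \<Rightarrow> real^'n \<Rightarrow> (real \<Rightarrow> real^'n \<Rightarrow> real^'n) \<Rightarrow> real \<Rightarrow> real^'n \<Rightarrow> real" where
  "twisted_div L e F \<xi> y = (\<Sum>i\<in>UNIV. twisted_partial L e i (\<lambda>s z. F s z $ i) \<xi> y)"

definition classical_profile ::
  "(real^'n \<Rightarrow> real^'n^'n) \<Rightarrow> (real^'n \<Rightarrow> real^'n) \<Rightarrow> (real^'n \<Rightarrow> real \<Rightarrow> real) \<Rightarrow> real \<Rightarrow> real^'n \<Rightarrow>
   (real \<Rightarrow> real^'n \<Rightarrow> real) \<Rightarrow> real \<Rightarrow> bool" where
  "classical_profile A B f L e \<phi> c \<longleftrightarrow>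
     (\<forall>\<xi>. periodic_ZN (\<phi> \<xi>)) \<and>
     Ck_on 2 UNIV (\<lambda>(\<xi>, y). \<phi> \<xi> y) \<and>
     (\<forall>\<xi> y. twisted_div L e (\<lambda>s z. A z *v twisted_grad L e \<phi> s z) \<xi> y
        + B y \<bullet> twisted_grad L e \<phi> \<xi> y
        + c * deriv (\<lambda>s. \<phi> s y) \<xi>
        + f y (\<phi> \<xi> y) = 0)"

end

theory Submission
  imports Defs
begin

text \<open>
  Everything rests on the maximum principle. If two entire solutions \<open>u\<close>, \<open>v\<close> satisfy, for all times
  before some \<open>T\<close>, that at every point \<open>v \<le> u\<close> or \<open>u \<ge> 1 - \<delta>\<close> or \<open>v \<le> \<delta>\<close>, then \<open>v \<le> u\<close> before \<open>T\<close>,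
  because \<open>f\<close> is decreasing wherever \<open>v > u\<close> and the bounded quantity \<open>(v - u)\<^sup>+\<close> has decayed from
  \<open>t = -\<infinity>\<close> on. As \<open>t \<rightarrow> -\<infinity>\<close> the front of a faster wave lies behind that of a slower one, so the faster
  wave is below the slower one, and stays so; this is absurd as \<open>t \<rightarrow> \<infinity>\<close>. Hence the speeds agree.

  For equal speeds, slide \<open>\<phi>\<close> until it is the lowest translate above \<open>\<phi>'\<close>. On a slab around the fronts
  the difference then has infimum \<open>0\<close>. Lattice and time translations bring a minimizing sequence back
  to a compact set. Since \<open>\<phi>'\<close> is only continuous, limits of the translates of the difference need not
  be classical solutions; a strong maximum principle with constants independent of the solution is
  applied to the translates themselves and still shows that the limit vanishes at all negative times.
\<close>

text \<open>The solution generated by \<open>\<phi>'\<close> sees it only at the frame points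
  \<open>(x . e - c t, x / L)\<close>. For \<open>c \<noteq> 0\<close> these fill the whole frame,
  so \<open>\<phi>'\<close> inherits continuity from its solution, and lattice vectors move every
  frame point to a negative time. For \<open>c = 0\<close> they form one hyperplane, and the contact
  found in the limit lies on a parallel one, offset by \<open>\<sigma>\<close>. That offset is
  itself a limit of numbers \<open>L (k . e)\<close> with lattice vectors \<open>k\<close>, so
  periodicity and the continuity of both profiles carry the identity back to the original
  hyperplane. The translations used for compactness therefore have to survive in the result of the
  sliding argument. Both maximum principles look at derivatives at single points only, which is why
  they are phrased through pointwise second-order data and not through function spaces.\<close>

section \<open>Frobenius products of semidefinite matrices\<close>

lemma inner_matrix_vec: "((a::real^'n^'n) *v d) \<bullet> d = (\<Sum>i\<in>UNIV. \<Sum>j\<in>UNIV. a $ i $ j * d $ i * d $ j)"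
  by (simp add: matrix_vector_mult_def inner_vec_def sum_distrib_right sum_distrib_left mult_ac)

lemma inner_outer_product:
  "(a::real^'n^'n) \<bullet> (\<chi> i j. v $ i * v $ j) = (a *v v) \<bullet> v"
  unfolding inner_matrix_vec by (simp add: inner_vec_def mult_ac)

text \<open>Gaussian elimination with pivot \<open>k\<close>: \<open>H\<close> is the rank-one
  matrix h h^T / H_kk plus its Schur complement \<open>H'\<close>, whose row and column
  \<open>k\<close> vanish, and the rank-one part pairs with \<open>a\<close> to a multiple of (a h)
  . h. A zero pivot forces the whole row to vanish. The set \<open>I\<close> of surviving indices
  allows induction on size within one matrix type.\<close>

lemma inner_psd_nonneg_supported:
  fixes a H :: "real^'n^'n"
  assumes "finite I"
    and "\<And>d. (a *v d) \<bullet> d \<ge> 0" and "\<And>d. (H *v d) \<bullet> d \<ge> 0"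
    and "transpose H = H" and "\<And>i j. H $ i $ j \<noteq> 0 \<Longrightarrow> i \<in> I \<and> j \<in> I"
  shows "a \<bullet> H \<ge> 0"
  using assms
proof (induction I arbitrary: H)
  case empty
  then have "H $ i $ j = 0" for i j by blast
  then have "H = 0" by (simp add: vec_eq_iff)
  then show ?case by simp
next
  case (insert k I)
  note psd = insert.prems(2)
  define h where "h = H $ k"
  have sym: "H $ i $ j = H $ j $ i" for i j
    using insert.prems(3) by (metis transpose_def vec_lambda_beta)
  have HhT: "(H *v d) $ k = h \<bullet> d" for d
    by (simp add: h_def matrix_vector_mult_def inner_vec_def)
  have Hax: "H *v axis k 1 = h"
    by (auto simp: matrix_vector_mult_basis column_def h_def vec_eq_iff sym)
  \<comment> \<open>A quadratic in \<open>s\<close>. With zero leading coefficient it is affine and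
    bounded below, so its slope vanishes; with a positive one its minimum is the form of the Schur
    complement.\<close>
  have key: "(H *v (d + s *\<^sub>R axis k 1)) \<bullet> (d + s *\<^sub>R axis k 1)
      = (H *v d) \<bullet> d + 2 * s * (h \<bullet> d) + s\<^sup>2 * H $ k $ k" for d s
  proof -
    have "(H *v (d + s *\<^sub>R axis k 1)) = H *v d + s *\<^sub>R h"
      by (simp add: matrix_vector_right_distrib matrix_vector_mult_scaleR Hax)
    then show ?thesis
      by (simp add: inner_add_left inner_add_right inner_axis HhT power2_eq_square algebra_simps)
        (auto simp add: h_def Hax[unfolded h_def])
  qed
  have kk: "H $ k $ k \<ge> 0"
    using psd[of "axis k 1"] by (simp add: Hax inner_axis h_def)
  show ?case
  proof (cases "H $ k $ k = 0")
    case True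
    have "h \<bullet> d = 0" for d
    proof (rule ccontr)
      assume n: "h \<bullet> d \<noteq> 0"
      define s where "s = - ((H *v d) \<bullet> d + 1) / (2 * (h \<bullet> d))"
      have "2 * s * (h \<bullet> d) = - ((H *v d) \<bullet> d + 1)" using n by (simp add: s_def field_simps)
      with key[of d s] True psd[of "d + s *\<^sub>R axis k 1"] show False by simp
    qed
    then have "h = 0" by (metis inner_eq_zero_iff)
    then have z: "H $ k $ j = 0" for j by (simp add: h_def)
    show ?thesis
    proof (rule insert.IH)
      show "i \<in> I \<and> j \<in> I" if "H $ i $ j \<noteq> 0" for i j
        using insert.prems(4)[OF that] that z sym by (metis insertE)
    qed (use insert.prems in auto)
  next
    case False
    with kk have pos: "H $ k $ k > 0" by simp
    define P where "P = (\<chi> i j. h $ i * h $ j)"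
    define H' where "H' = H - (1 / H $ k $ k) *\<^sub>R P"
    have Pd: "(P *v d) \<bullet> d = (h \<bullet> d)\<^sup>2" for d
      unfolding inner_matrix_vec P_def
      by (simp add: power2_eq_square inner_vec_def sum_product mult_ac)
    have H'd: "(H' *v d) \<bullet> d = (H *v d) \<bullet> d - (h \<bullet> d)\<^sup>2 / H $ k $ k" for d
      by (simp add: H'_def matrix_vector_mult_diff_rdistrib inner_diff_left scaleR_matrix_vector_assoc[symmetric] Pd)
    have "a \<bullet> H' \<ge> 0"
    proof (rule insert.IH)
      show "(a *v d) \<bullet> d \<ge> 0" for d using insert.prems by auto
      show "(H' *v d) \<bullet> d \<ge> 0" for d
      proof -
        define s where "s = - (h \<bullet> d) / H $ k $ k"
        have "2 * s * (h \<bullet> d) + s\<^sup>2 * H $ k $ k = - (h \<bullet> d)\<^sup>2 / H $ k $ k"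
          using pos by (simp add: s_def field_simps power2_eq_square)
        with key[of d s] psd[of "d + s *\<^sub>R axis k 1"] show ?thesis by (simp add: H'd)
      qed
      show "transpose H' = H'"
        by (simp add: vec_eq_iff transpose_def H'_def P_def sym)
      show "i \<in> I \<and> j \<in> I" if n: "H' $ i $ j \<noteq> 0" for i j
      proof -
        have c: "H' $ i $ j = H $ i $ j - H $ k $ i * H $ k $ j / H $ k $ k" for i j
          by (simp add: H'_def P_def h_def)
        have "i \<noteq> k" "j \<noteq> k" using n pos sym[of i k] by (auto simp: c)
        moreover have "i \<in> insert k I" "j \<in> insert k I"
          using n insert.prems(4)[of i j] insert.prems(4)[of k i] insert.prems(4)[of k j]
          unfolding c by (metis diff_zero div_0 mult_eq_0_iff)+
        ultimately show ?thesis by auto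
      qed
    qed
    moreover have "a \<bullet> P \<ge> 0" using insert.prems by (simp add: P_def inner_outer_product)
    moreover have "H = H' + (1 / H $ k $ k) *\<^sub>R P" by (simp add: H'_def)
    ultimately show ?thesis using pos
      by (metis add_nonneg_nonneg divide_nonneg_nonneg inner_add_right inner_scaleR_right kk mult_nonneg_nonneg zero_le_one)
  qed
qed

text \<open>Gives the sign of the second-order term at a spatial maximum, with \<open>a\<close> the
  diffusion matrix, symmetric or not, and \<open>H\<close> the Hessian.\<close>

lemma inner_nsd_nonpos:
  fixes a H :: "real^'n^'n"
  assumes "\<And>d. (a *v d) \<bullet> d \<ge> 0" and "\<And>d. (H *v d) \<bullet> d \<le> 0" and "transpose H = H"
  shows "a \<bullet> H \<le> 0"
proof -
  have m: "- H = (-1) *\<^sub>R H" by simp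
  have "a \<bullet> (- H) \<ge> 0"
  proof (rule inner_psd_nonneg_supported[of UNIV])
    show "(- H *v d) \<bullet> d \<ge> 0" for d
      using assms(2)[of d] unfolding m scaleR_matrix_vector_assoc[symmetric] by simp
    show "transpose (- H) = - H"
      using assms(3) by (simp add: vec_eq_iff transpose_def)
  qed (use assms in auto)
  then show ?thesis by simp
qed

text \<open>
  Second-order data of \<open>w\<close> at \<open>(t, x)\<close>: time derivative, spatial gradient and Hessian, the latter
  two only through one-dimensional restrictions to lines through \<open>x\<close>.
\<close>

definition jet ::
  "(real \<Rightarrow> real^'n \<Rightarrow> real) \<Rightarrow> real \<Rightarrow> real^'n \<Rightarrow> real \<Rightarrow> real^'n \<Rightarrow> real^'n^'n \<Rightarrow> bool" where
  "jet w t x \<alpha> p H \<longleftrightarrow>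
     ((\<lambda>s. w s x) has_real_derivative \<alpha>) (at t) \<and> transpose H = H \<and>
     (\<forall>d. \<exists>g. (\<forall>\<^sub>F s in nhds 0. ((\<lambda>s. w t (x + s *\<^sub>R d)) has_real_derivative g s) (at s)) \<and>
          g 0 = p \<bullet> d \<and> (g has_real_derivative (H *v d) \<bullet> d) (at 0))"

section \<open>Calculus of jets and their signs at a maximum\<close>

lemma jet_diff:
  assumes "jet v t x \<alpha> p H" and "jet w t x \<beta> q K"
  shows "jet (\<lambda>t x. v t x - w t x) t x (\<alpha> - \<beta>) (p - q) (H - K)"
  unfolding jet_def
proof (intro conjI allI)
  show "((\<lambda>s. v s x - w s x) has_real_derivative \<alpha> - \<beta>) (at t)"
    using assms by (auto simp: jet_def intro!: derivative_intros)
  show "transpose (H - K) = H - K"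
    using assms by (simp add: jet_def transpose_def vec_eq_iff)
  fix d
  obtain g where g: "\<forall>\<^sub>F s in nhds 0. ((\<lambda>s. v t (x + s *\<^sub>R d)) has_real_derivative g s) (at s)"
      "g 0 = p \<bullet> d" "(g has_real_derivative (H *v d) \<bullet> d) (at 0)"
    using assms(1) unfolding jet_def by blast
  obtain h where h: "\<forall>\<^sub>F s in nhds 0. ((\<lambda>s. w t (x + s *\<^sub>R d)) has_real_derivative h s) (at s)"
      "h 0 = q \<bullet> d" "(h has_real_derivative (K *v d) \<bullet> d) (at 0)"
    using assms(2) unfolding jet_def by blast
  show "\<exists>g. (\<forall>\<^sub>F s in nhds 0. ((\<lambda>s. v t (x + s *\<^sub>R d) - w t (x + s *\<^sub>R d)) has_real_derivative g s) (at s)) \<and>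
          g 0 = (p - q) \<bullet> d \<and> (g has_real_derivative ((H - K) *v d) \<bullet> d) (at 0)"
  proof (intro exI[of _ "\<lambda>s. g s - h s"] conjI)
    show "\<forall>\<^sub>F s in nhds 0. ((\<lambda>s. v t (x + s *\<^sub>R d) - w t (x + s *\<^sub>R d)) has_real_derivative g s - h s) (at s)"
      using g(1) h(1) by eventually_elim (auto intro!: derivative_intros)
    show "((\<lambda>s. g s - h s) has_real_derivative ((H - K) *v d) \<bullet> d) (at 0)"
      using DERIV_diff[OF g(3) h(3)] by (simp add: matrix_vector_mult_diff_rdistrib inner_diff_left)
  qed (simp add: g h inner_diff_left)
qed

lemma jet_mult_time:
  assumes "jet w t x \<alpha> p H" and "(\<theta> has_real_derivative \<theta>') (at t)"
  shows "jet (\<lambda>t x. \<theta> t * w t x) t x (\<theta>' * w t x + \<theta> t * \<alpha>) (\<theta> t *\<^sub>R p) (\<theta> t *\<^sub>R H)"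
  unfolding jet_def
proof (intro conjI allI)
  have "((\<lambda>s. w s x) has_real_derivative \<alpha>) (at t)" using assms by (simp add: jet_def)
  from DERIV_mult[OF assms(2) this]
  show "((\<lambda>s. \<theta> s * w s x) has_real_derivative (\<theta>' * w t x + \<theta> t * \<alpha>)) (at t)"
    by (simp add: algebra_simps)
  show "transpose (\<theta> t *\<^sub>R H) = \<theta> t *\<^sub>R H"
    using assms by (simp add: jet_def transpose_def vec_eq_iff)
  fix d
  obtain g where g: "\<forall>\<^sub>F s in nhds 0. ((\<lambda>s. w t (x + s *\<^sub>R d)) has_real_derivative g s) (at s)"
      "g 0 = p \<bullet> d" "(g has_real_derivative (H *v d) \<bullet> d) (at 0)"
    using assms(1) unfolding jet_def by blast
  show "\<exists>g. (\<forall>\<^sub>F s in nhds 0. ((\<lambda>s. \<theta> t * w t (x + s *\<^sub>R d)) has_real_derivative g s) (at s)) \<and>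
          g 0 = (\<theta> t *\<^sub>R p) \<bullet> d \<and> (g has_real_derivative ((\<theta> t *\<^sub>R H) *v d) \<bullet> d) (at 0)"
  proof (intro exI[of _ "\<lambda>s. \<theta> t * g s"] conjI)
    show "\<forall>\<^sub>F s in nhds 0. ((\<lambda>s. \<theta> t * w t (x + s *\<^sub>R d)) has_real_derivative \<theta> t * g s) (at s)"
      using g(1) by eventually_elim (auto intro!: derivative_eq_intros)
    show "((\<lambda>s. \<theta> t * g s) has_real_derivative ((\<theta> t *\<^sub>R H) *v d) \<bullet> d) (at 0)"
      using DERIV_cmult[OF g(3), of "\<theta> t"] by (simp add: scaleR_matrix_vector_assoc[symmetric])
  qed (simp add: g)
qed

text \<open>Serves the truncated bump, which agrees with a smooth function only on the open set
  where it is positive.\<close>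

lemma jet_cong_local:
  assumes "jet v t x \<alpha> p H" and "open S" "(t, x) \<in> S" and "\<And>s y. (s, y) \<in> S \<Longrightarrow> v s y = w s y"
  shows "jet w t x \<alpha> p H"
  unfolding jet_def
proof (intro conjI allI)
  have ev: "\<forall>\<^sub>F s in nhds a. v (\<tau> s) (\<xi> s) = w (\<tau> s) (\<xi> s)"
    if "continuous_on UNIV \<tau>" "continuous_on UNIV \<xi>" "(\<tau> a, \<xi> a) \<in> S" for \<tau> and \<xi> :: "real \<Rightarrow> _" and a :: real
  proof -
    have "open ((\<lambda>s. (\<tau> s, \<xi> s)) -` S)"
      using assms(2) that by (intro open_vimage continuous_intros) auto
    then show ?thesis
      using that(3) assms(4) unfolding eventually_nhds
      by (intro exI[of _ "(\<lambda>s. (\<tau> s, \<xi> s)) -` S"]) simp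
  qed
  have "\<forall>\<^sub>F s in nhds t. v s x = w s x"
    by (rule ev[of "\<lambda>s. s" "\<lambda>_. x"]) (use assms(3) in auto)
  then show "((\<lambda>s. w s x) has_real_derivative \<alpha>) (at t)"
    using assms(1) DERIV_cong_ev[OF refl _ refl, of "\<lambda>s. v s x" "\<lambda>s. w s x" t \<alpha>] by (auto simp: jet_def)
  show "transpose H = H" using assms(1) by (simp add: jet_def)
  fix d
  obtain g where g: "\<forall>\<^sub>F s in nhds 0. ((\<lambda>s. v t (x + s *\<^sub>R d)) has_real_derivative g s) (at s)"
      "g 0 = p \<bullet> d" "(g has_real_derivative (H *v d) \<bullet> d) (at 0)"
    using assms(1) unfolding jet_def by blast
  have "\<forall>\<^sub>F s in nhds 0. v t (x + s *\<^sub>R d) = w t (x + s *\<^sub>R d)"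
    by (rule ev[of "\<lambda>_. t" "\<lambda>s. x + s *\<^sub>R d"]) (use assms(3) in \<open>auto intro!: continuous_intros\<close>)
  \<comment> \<open>The derivative has to be transferred at every \<open>s\<close> near 0, so the
    agreement is needed around each such \<open>s\<close>.\<close>
  then have "\<forall>\<^sub>F s in nhds 0. \<forall>\<^sub>F r in nhds s. v t (x + r *\<^sub>R d) = w t (x + r *\<^sub>R d)"
    by (subst eventually_eventually)
  with g(1) have "\<forall>\<^sub>F s in nhds 0. ((\<lambda>s. w t (x + s *\<^sub>R d)) has_real_derivative g s) (at s)"
    by eventually_elim (subst (asm) DERIV_cong_ev[OF refl _ refl], auto)
  with g(2,3) show "\<exists>g. (\<forall>\<^sub>F s in nhds 0. ((\<lambda>s. w t (x + s *\<^sub>R d)) has_real_derivative g s) (at s)) \<and>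
          g 0 = p \<bullet> d \<and> (g has_real_derivative (H *v d) \<bullet> d) (at 0)" by blast
qed

text \<open>If \<open>c > 0\<close>, then \<open>g\<close> is positive just to the right of 0, and
  the mean value theorem lifts \<open>k\<close> above its maximum. Only the derivative of
  \<open>g\<close> at the single point 0 is available.\<close>

lemma second_derivative_nonpos_at_max:
  fixes k :: "real \<Rightarrow> real"
  assumes k: "\<forall>\<^sub>F s in nhds 0. (k has_real_derivative g s) (at s)"
    and max: "\<forall>s. k s \<le> k 0"
    and g: "(g has_real_derivative c) (at 0)"
  shows "g 0 = 0" and "c \<le> 0"
proof -
  have k0: "(k has_real_derivative g 0) (at 0)" using eventually_nhds_x_imp_x[OF k] .
  show g0: "g 0 = 0"
    using DERIV_local_max[OF k0, of 1] max by auto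
  show "c \<le> 0"
  proof (rule ccontr)
    assume "\<not> c \<le> 0"
    then obtain d where d: "d > 0" "\<And>h. h > 0 \<Longrightarrow> h < d \<Longrightarrow> g 0 < g (0 + h)"
      using DERIV_pos_inc_right[OF g] by auto
    obtain e where e: "e > 0" "\<And>s. \<bar>s\<bar> < e \<Longrightarrow> (k has_real_derivative g s) (at s)"
      using k by (auto simp: eventually_nhds_metric dist_real_def)
    define h where "h = min d e / 2"
    have h: "h > 0" "h < d" "h < e" using d(1) e(1) by (auto simp: h_def min_def)
    obtain z where z: "0 < z" "z < h" "k h - k 0 = (h - 0) * g z"
      using MVT2[of 0 h k g] e(2) h by auto
    have "g z > 0" using d(2)[of z] z h g0 by auto
    with h have "h * g z > 0" by simp
    with z(3) max[rule_format, of h] show False by simp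
  qed
qed

text \<open>The maximum in time is over the past alone, hence an inequality for
  \<open>\<alpha>\<close> and not an equation; this admits the final time of an interval.\<close>

lemma jet_at_max:
  assumes j: "jet w t x \<alpha> p H"
    and space: "\<And>y. w t y \<le> w t x"
    and time: "t0 < t" "\<And>s. t0 \<le> s \<Longrightarrow> s \<le> t \<Longrightarrow> w s x \<le> w t x"
  shows "\<alpha> \<ge> 0" and "p = 0" and "\<And>d. (H *v d) \<bullet> d \<le> 0"
proof -
  have *: "p \<bullet> d = 0 \<and> (H *v d) \<bullet> d \<le> 0" for d
  proof -
    obtain g where g: "\<forall>\<^sub>F s in nhds 0. ((\<lambda>s. w t (x + s *\<^sub>R d)) has_real_derivative g s) (at s)"
      "g 0 = p \<bullet> d" "(g has_real_derivative (H *v d) \<bullet> d) (at 0)"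
      using j unfolding jet_def by blast
    show ?thesis
      using second_derivative_nonpos_at_max[OF g(1) _ g(3)] space g(2) by auto
  qed
  from * have "p \<bullet> p = 0" by blast
  then show "p = 0" by simp
  from * show "\<And>d. (H *v d) \<bullet> d \<le> 0" by blast
  show "\<alpha> \<ge> 0"
  proof (rule ccontr)
    assume "\<not> \<alpha> \<ge> 0"
    with j obtain d where d: "d > 0" "\<And>h. h > 0 \<Longrightarrow> h < d \<Longrightarrow> w t x < w (t - h) x"
      using DERIV_neg_dec_left[of "\<lambda>s. w s x" \<alpha> t] by (auto simp: jet_def)
    define h where "h = min (d/2) (t - t0)"
    have "h > 0" "h < d" "t0 \<le> t - h" using d(1) time(1) by (auto simp: h_def min_def)
    with d(2)[of h] time(2)[of "t - h"] show False by linarith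
  qed
qed

section \<open>Maximum principle on the whole space\<close>

lemma jet_const: "jet (\<lambda>t x. m) t x 0 0 0"
  unfolding jet_def
  by (auto simp: transpose_def vec_eq_iff intro!: exI[of _ "\<lambda>_. 0"] derivative_eq_intros)

lemma jet_quadratic:
  fixes x :: "real^'n"
  shows "jet (\<lambda>t x. 1 + x \<bullet> x) t x 0 (2 *\<^sub>R x) (2 *\<^sub>R mat 1)"
  unfolding jet_def
proof (intro conjI allI)
  show "((\<lambda>s. 1 + x \<bullet> x) has_real_derivative 0) (at t)" by simp
  show "transpose (2 *\<^sub>R mat 1 :: real^'n^'n) = 2 *\<^sub>R mat 1"
    by (simp add: transpose_def vec_eq_iff mat_def)
  fix d :: "real^'n"
  have exp: "1 + (x + s *\<^sub>R d) \<bullet> (x + s *\<^sub>R d) = 1 + x \<bullet> x + 2 * s * (x \<bullet> d) + s\<^sup>2 * (d \<bullet> d)" for s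
    by (simp add: inner_add_left inner_add_right inner_commute power2_eq_square algebra_simps)
  show "\<exists>g. (\<forall>\<^sub>F s in nhds 0. ((\<lambda>s. 1 + (x + s *\<^sub>R d) \<bullet> (x + s *\<^sub>R d)) has_real_derivative g s) (at s)) \<and>
          g 0 = (2 *\<^sub>R x) \<bullet> d \<and> (g has_real_derivative ((2 *\<^sub>R mat 1) *v d) \<bullet> d) (at 0)"
    unfolding exp
    by (intro exI[of _ "\<lambda>s. 2 * (x \<bullet> d) + 2 * s * (d \<bullet> d)"] conjI always_eventually allI)
      (auto intro!: derivative_eq_intros simp: scaleR_matrix_vector_assoc[symmetric])
qed

text \<open>
  The comparison function \<open>1 + |x|\<^sup>2\<close>, growing exponentially in time, confines the maximum to a
  compact set.
\<close>

lemma max_principle: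
  fixes a :: "real^'n \<Rightarrow> real^'n^'n" and b :: "real^'n \<Rightarrow> real^'n"
  assumes ell: "\<And>x d. (a x *v d) \<bullet> d \<ge> 0" and tr: "\<And>x. a x \<bullet> mat 1 \<le> C" and b: "\<And>x. norm (b x) \<le> C"
    and cont: "continuous_on ({t0..t1} \<times> UNIV) (\<lambda>(t, x). w t x)"
    and bdd: "\<And>t x. t \<in> {t0..t1} \<Longrightarrow> w t x \<le> M"
    and m: "m \<ge> 0" and init: "\<And>x. w t0 x \<le> m"
    and sub: "\<And>t x. t0 < t \<Longrightarrow> t \<le> t1 \<Longrightarrow> w t x > 0 \<Longrightarrow>
       \<exists>\<alpha> p H. jet w t x \<alpha> p H \<and> \<alpha> \<le> a x \<bullet> H + b x \<bullet> p + \<kappa> * w t x"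
    and t: "t \<in> {t0..t1}"
  shows "w t x \<le> m * exp (\<kappa> * (t - t0))"
proof -
  \<comment> \<open>This factor cancels the zeroth-order term \<open>\<kappa> * w\<close>, so that
    the constant \<open>m\<close> becomes a barrier for \<open>v\<close>.\<close>
  define \<theta> where "\<theta> t = exp (- \<kappa> * (t - t0))" for t
  define v where "v t x = \<theta> t * w t x" for t x
  \<comment> \<open>\<open>2 * C\<close> absorbs the trace term and \<open>C\<close> the drift, by 2
    |y| \<le> 1 + |y|^2; the extra \<open>1\<close> makes the final inequality strict.\<close>
  define lam where "lam = 3 * C + 1"
  have C: "C \<ge> 0" using order_trans[OF norm_ge_zero b] .
  have bnd: "v t x \<le> m + \<epsilon> * exp (lam * (t - t0)) * (1 + x \<bullet> x)"
    if \<epsilon>: "\<epsilon> > 0" and t: "t \<in> {t0..t1}" for \<epsilon> t x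
  proof (rule ccontr)
    assume neg: "\<not> ?thesis"
    define E where "E t = \<epsilon> * exp (lam * (t - t0))" for t
    define z where "z t x = v t x - m - E t * (1 + x \<bullet> x)" for t x
    have zpos: "z t x > 0" using neg by (simp add: z_def E_def)
    define M' where "M' = exp (\<bar>\<kappa>\<bar> * (t1 - t0)) * \<bar>M\<bar>"
    have vM: "v s y \<le> M'" if "s \<in> {t0..t1}" for s y
    proof -
      have "- \<kappa> * (s - t0) \<le> \<bar>\<kappa>\<bar> * (t1 - t0)"
        using that by (intro mult_mono) auto
      then have "\<theta> s \<le> exp (\<bar>\<kappa>\<bar> * (t1 - t0))" by (simp add: \<theta>_def)
      moreover have "w s y \<le> \<bar>M\<bar>" using bdd[OF that, of y] by simp
      ultimately have "\<theta> s * w s y \<le> exp (\<bar>\<kappa>\<bar> * (t1 - t0)) * \<bar>M\<bar>"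
        by (intro order_trans[OF mult_left_mono[of "w s y" "\<bar>M\<bar>"] mult_right_mono]) (auto simp: \<theta>_def)
      then show ?thesis by (simp add: v_def M'_def)
    qed
    have Eeps: "E s \<ge> \<epsilon>" if "s \<ge> t0" for s
      using that \<epsilon> C by (simp add: E_def lam_def)
    have Epos: "E s > 0" for s using \<epsilon> by (simp add: E_def)
    \<comment> \<open>Where \<open>z\<close> is positive, the barrier is below \<open>M'\<close>,
      yet it is at least \<open>\<epsilon>\<close> times |y| because |y| \<le> 1 + |y|^2.\<close>
    define R where "R = M' / \<epsilon>"
    have inside: "y \<in> cball 0 R" if "s \<in> {t0..t1}" "z s y > 0" for s y
    proof -
      have "\<epsilon> * norm y \<le> E s * (1 + y \<bullet> y)"
      proof (rule mult_mono)
        have "0 \<le> (norm y - 1)\<^sup>2 + (norm y)\<^sup>2 + 1" by simp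
        then show "norm y \<le> 1 + y \<bullet> y" by (simp add: power2_norm_eq_inner power2_diff)
      qed (use Eeps that Epos[of s] in auto)
      also have "\<dots> < M'" using that vM[OF that(1), of y] m by (simp add: z_def)
      finally show ?thesis using \<epsilon> by (simp add: R_def field_simps)
    qed
    define Kc where "Kc = {t0..t1} \<times> cball (0::real^'n) R"
    have zc: "continuous_on Kc (\<lambda>(t, x). z t x)"
    proof -
      have "continuous_on Kc (\<lambda>q. w (fst q) (snd q))"
        using continuous_on_subset[OF cont, of Kc] by (auto simp: Kc_def case_prod_unfold)
      then show ?thesis
        unfolding z_def v_def \<theta>_def E_def case_prod_unfold by (intro continuous_intros)
    qed
    have "compact Kc" unfolding Kc_def by (intro compact_Times) auto
    moreover have tx: "(t, x) \<in> Kc" using inside[OF t zpos] t by (auto simp: Kc_def)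
    ultimately obtain q where q: "q \<in> Kc" "\<And>r. r \<in> Kc \<Longrightarrow> (\<lambda>(t, x). z t x) r \<le> (\<lambda>(t, x). z t x) q"
      using continuous_attains_sup[of Kc "\<lambda>(t, x). z t x"] zc by (metis empty_iff)
    obtain s y where sy: "q = (s, y)" by force
    have s: "s \<in> {t0..t1}" using q(1) by (auto simp: sy Kc_def)
    have zsy: "z s y > 0" using q(2)[OF tx] zpos by (simp add: sy)
    \<comment> \<open>Points outside the ball have \<open>z \<le> 0\<close>, so the maximum over the
      compact set is one over all of space, as the test at a maximum demands.\<close>
    have glob: "z s' y' \<le> z s y" if "s' \<in> {t0..t1}" for s' y'
      using inside[OF that, of y'] q(2)[of "(s', y')"] that zsy by (force simp: sy Kc_def)
    have s0: "t0 < s"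
    proof (rule ccontr)
      assume "\<not> t0 < s"
      then have "s = t0" using s by auto
      then have "z s y \<le> - (E s * (1 + y \<bullet> y))"
        using init[of y] by (simp add: z_def v_def \<theta>_def)
      moreover have "E s * (1 + y \<bullet> y) \<ge> 0" using Epos[of s] by (intro mult_nonneg_nonneg) auto
      ultimately show False using zsy by simp
    qed
    have "v s y > 0"
    proof -
      have "E s * (1 + y \<bullet> y) \<ge> 0" using Epos[of s] by (intro mult_nonneg_nonneg) auto
      then show ?thesis using zsy m by (simp add: z_def)
    qed
    then have wsy: "w s y > 0" by (simp add: v_def \<theta>_def zero_less_mult_iff)
    obtain \<alpha> p H where J: "jet w s y \<alpha> p H" and le: "\<alpha> \<le> a y \<bullet> H + b y \<bullet> p + \<kappa> * w s y"
      using sub[OF s0 _ wsy] s by (meson atLeastAtMost_iff)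
    have d\<theta>: "(\<theta> has_real_derivative - \<kappa> * \<theta> s) (at s)"
      unfolding \<theta>_def by (auto intro!: derivative_eq_intros)
    have dE: "(E has_real_derivative lam * E s) (at s)"
      unfolding E_def by (auto intro!: derivative_eq_intros)
    define I where "I = (2 *\<^sub>R mat 1 :: real^'n^'n)"
    have Jz: "jet z s y ((- \<kappa> * \<theta> s * w s y + \<theta> s * \<alpha>) - 0 - (lam * E s * (1 + y \<bullet> y) + E s * 0))
        (\<theta> s *\<^sub>R p - 0 - E s *\<^sub>R (2 *\<^sub>R y)) (\<theta> s *\<^sub>R H - 0 - E s *\<^sub>R I)"
      using jet_diff[OF jet_diff[OF jet_mult_time[OF J d\<theta>] jet_const[of m]] jet_mult_time[OF jet_quadratic dE]]
      by (simp add: z_def[abs_def] v_def[abs_def] I_def)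
    have mx: "\<And>y'. z s y' \<le> z s y" "\<And>s'. t0 \<le> s' \<Longrightarrow> s' \<le> s \<Longrightarrow> z s' y \<le> z s y"
      using glob s by auto
    note crit = jet_at_max[OF Jz mx(1) s0 mx(2)]
    have p: "\<theta> s *\<^sub>R p = E s *\<^sub>R (2 *\<^sub>R y)" using crit(2) by simp
    have "a y \<bullet> (\<theta> s *\<^sub>R H - 0 - E s *\<^sub>R I) \<le> 0"
      by (rule inner_nsd_nonpos[OF ell crit(3)]) (use Jz in \<open>simp_all add: jet_def\<close>)
    then have aH: "\<theta> s * (a y \<bullet> H) \<le> E s * (2 * (a y \<bullet> mat 1))"
      by (simp add: inner_diff_right I_def)
    have "\<theta> s * (b y \<bullet> p) = b y \<bullet> (\<theta> s *\<^sub>R p)" by simp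
    also have "\<dots> = E s * (2 * (b y \<bullet> y))" unfolding p by simp
    finally have bp: "\<theta> s * (b y \<bullet> p) = E s * (2 * (b y \<bullet> y))" .
    have "\<theta> s * \<alpha> \<le> \<theta> s * (a y \<bullet> H + b y \<bullet> p + \<kappa> * w s y)"
      using le by (intro mult_left_mono) (auto simp: \<theta>_def)
    with crit(1) have "0 \<le> \<theta> s * (a y \<bullet> H) + \<theta> s * (b y \<bullet> p) - lam * E s * (1 + y \<bullet> y)"
      by (simp add: algebra_simps)
    also have "\<dots> \<le> E s * (2 * (a y \<bullet> mat 1) + 2 * (b y \<bullet> y) - lam * (1 + y \<bullet> y))"
      using aH bp by (simp add: algebra_simps)
    also have "\<dots> < 0"
    proof -
      have "2 * (b y \<bullet> y) \<le> 2 * (C * norm y)"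
        using norm_cauchy_schwarz[of "b y" y] mult_right_mono[OF b[of y], of "norm y"] by simp
      also have "\<dots> \<le> C * (1 + y \<bullet> y)"
      proof -
        have "0 \<le> C * (norm y - 1)\<^sup>2" using C by simp
        then show ?thesis by (simp add: power2_norm_eq_inner power2_diff algebra_simps)
      qed
      finally have 1: "2 * (b y \<bullet> y) \<le> C * (1 + y \<bullet> y)" .
      have 2: "2 * (a y \<bullet> mat 1) \<le> 2 * C * (1 + y \<bullet> y)"
      proof -
        have "0 \<le> C * (y \<bullet> y)" using C by simp
        then show ?thesis using tr[of y] by (simp add: algebra_simps)
      qed
      have "1 + y \<bullet> y > 0" by (simp add: add_pos_nonneg)
      with 1 2 have "2 * (a y \<bullet> mat 1) + 2 * (b y \<bullet> y) - lam * (1 + y \<bullet> y) < 0"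
        by (simp add: lam_def algebra_simps)
      then show ?thesis using Epos[of s] by (simp add: mult_less_0_iff)
    qed
    finally show False by simp
  qed
  \<comment> \<open>At a fixed point the barrier is \<open>\<epsilon>\<close> times a constant
    \<open>k\<close>, so the choice \<open>e / k\<close> costs exactly \<open>e\<close>.\<close>
  have "v t x \<le> m + e" if "e > 0" for e
  proof -
    define k where "k = exp (lam * (t - t0)) * (1 + x \<bullet> x)"
    have k: "k > 0" by (simp add: k_def add_pos_nonneg)
    have "v t x \<le> m + (e / k) * exp (lam * (t - t0)) * (1 + x \<bullet> x)"
      using bnd[OF _ t, of "e / k" x] that k by simp
    also have "(e / k) * exp (lam * (t - t0)) * (1 + x \<bullet> x) = e / k * k"
      by (simp only: k_def mult.assoc)
    finally show ?thesis using k by simp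
  qed
  then have "v t x \<le> m" by (rule field_le_epsilon)
  moreover have "w t x = exp (\<kappa> * (t - t0)) * v t x"
    by (simp add: v_def \<theta>_def exp_minus)
  ultimately show ?thesis by (simp add: mult.commute)
qed

section \<open>Strong maximum principle with uniform constants\<close>

text \<open>The square is what makes a subsolution possible: it adds 8 y y^T to the Hessian, a term
  of the good sign that stays large at the edge of the moving ball, where \<open>\<rho>\<close> and
  with it all other terms vanish. The velocity \<open>V\<close> shows only in the time
  derivative.\<close>

lemma jet_bump:
  fixes x0 V x :: "real^'n" and r t0 t :: real
  defines "\<rho> \<equiv> \<lambda>t x. r\<^sup>2 - (x - x0 - (t - t0) *\<^sub>R V) \<bullet> (x - x0 - (t - t0) *\<^sub>R V)"
  defines "y \<equiv> \<lambda>t x. x - x0 - (t - t0) *\<^sub>R V"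
  shows "jet (\<lambda>t x. (\<rho> t x)\<^sup>2) t x (4 * \<rho> t x * (y t x \<bullet> V)) (- (4 * \<rho> t x) *\<^sub>R y t x)
     (8 *\<^sub>R (\<chi> i j. y t x $ i * y t x $ j) - (4 * \<rho> t x) *\<^sub>R mat 1)"
  unfolding jet_def
proof (intro conjI allI)
  have \<rho>t: "\<rho> s x = \<rho> t x + 2 * (s - t) * (y t x \<bullet> V) - (s - t)\<^sup>2 * (V \<bullet> V)" for s
  proof -
    have eq: "x - x0 - (s - t0) *\<^sub>R V = y t x - (s - t) *\<^sub>R V"
      by (simp add: y_def algebra_simps)
    have "\<rho> s x = r\<^sup>2 - (y t x - (s - t) *\<^sub>R V) \<bullet> (y t x - (s - t) *\<^sub>R V)"
      unfolding \<rho>_def eq ..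
    moreover have "\<rho> t x = r\<^sup>2 - y t x \<bullet> y t x" by (simp add: \<rho>_def y_def)
    ultimately show ?thesis
      by (simp add: inner_simps inner_commute power2_eq_square algebra_simps)
  qed
  have "((\<lambda>s. (\<rho> t x + 2 * (s - t) * (y t x \<bullet> V) - (s - t)\<^sup>2 * (V \<bullet> V))\<^sup>2)
      has_real_derivative 4 * \<rho> t x * (y t x \<bullet> V)) (at t)"
    by (auto intro!: derivative_eq_intros)
  then show "((\<lambda>s. (\<rho> s x)\<^sup>2) has_real_derivative 4 * \<rho> t x * (y t x \<bullet> V)) (at t)"
    unfolding \<rho>t[symmetric] .
  show "transpose (8 *\<^sub>R (\<chi> i j. y t x $ i * y t x $ j) - (4 * \<rho> t x) *\<^sub>R mat 1)
      = 8 *\<^sub>R (\<chi> i j. y t x $ i * y t x $ j) - (4 * \<rho> t x) *\<^sub>R mat 1"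
    by (simp add: transpose_def vec_eq_iff mat_def mult_ac)
  fix d :: "real^'n"
  have \<rho>x: "\<rho> t (x + s *\<^sub>R d) = \<rho> t x - 2 * s * (y t x \<bullet> d) - s\<^sup>2 * (d \<bullet> d)" for s
  proof -
    have eq: "x + s *\<^sub>R d - x0 - (t - t0) *\<^sub>R V = y t x + s *\<^sub>R d"
      by (simp add: y_def algebra_simps)
    have "\<rho> t (x + s *\<^sub>R d) = r\<^sup>2 - (y t x + s *\<^sub>R d) \<bullet> (y t x + s *\<^sub>R d)"
      unfolding \<rho>_def eq ..
    moreover have "\<rho> t x = r\<^sup>2 - y t x \<bullet> y t x" by (simp add: \<rho>_def y_def)
    ultimately show ?thesis
      by (simp add: inner_simps inner_commute power2_eq_square algebra_simps)
  qed
  have outer: "((\<chi> i j. y t x $ i * y t x $ j) *v d) \<bullet> d = (y t x \<bullet> d)\<^sup>2"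
    unfolding inner_matrix_vec
    by (simp add: power2_eq_square inner_vec_def sum_product mult_ac)
  show "\<exists>g. (\<forall>\<^sub>F s in nhds 0. ((\<lambda>s. (\<rho> t (x + s *\<^sub>R d))\<^sup>2) has_real_derivative g s) (at s)) \<and>
      g 0 = (- (4 * \<rho> t x) *\<^sub>R y t x) \<bullet> d \<and>
      (g has_real_derivative
         ((8 *\<^sub>R (\<chi> i j. y t x $ i * y t x $ j) - (4 * \<rho> t x) *\<^sub>R mat 1) *v d) \<bullet> d) (at 0)"
    unfolding \<rho>x
  proof (intro exI conjI always_eventually allI)
    let ?g = "\<lambda>s. 2 * (\<rho> t x - 2 * s * (y t x \<bullet> d) - s\<^sup>2 * (d \<bullet> d)) * (- 2 * (y t x \<bullet> d) - 2 * s * (d \<bullet> d))"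
    show "((\<lambda>s. (\<rho> t x - 2 * s * (y t x \<bullet> d) - s\<^sup>2 * (d \<bullet> d))\<^sup>2) has_real_derivative ?g s) (at s)" for s
      by (auto intro!: derivative_eq_intros simp: algebra_simps)
    show "?g 0 = (- (4 * \<rho> t x) *\<^sub>R y t x) \<bullet> d" by simp
    show "(?g has_real_derivative
         ((8 *\<^sub>R (\<chi> i j. y t x $ i * y t x $ j) - (4 * \<rho> t x) *\<^sub>R mat 1) *v d) \<bullet> d) (at 0)"
      by (auto intro!: derivative_eq_intros
          simp: matrix_vector_mult_diff_rdistrib scaleR_matrix_vector_assoc[symmetric] inner_diff_left outer
            power2_eq_square algebra_simps)
  qed
qed

text \<open>
  With \<open>h = T V\<close>, the subsolution \<open>e\<^bsup>-l(t-t0)\<^esup> (r\<^sup>2 - |y|\<^sup>2)\<^sub>+\<^sup>2\<close>, \<open>y = x - x0 - (t-t0)V\<close>, transports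
  positivity from the ball around \<open>x0\<close> to \<open>x0 + h\<close>: where the bump is small the term \<open>8 y \<bullet> a y\<close> of the
  operator dominates, elsewhere \<open>l\<close> does.
\<close>

lemma strong_positivity:
  fixes a :: "real^'n \<Rightarrow> real^'n^'n" and b :: "real^'n \<Rightarrow> real^'n" and h :: "real^'n"
  assumes \<eta>: "\<eta> > 0" and ell: "\<And>x d. (a x *v d) \<bullet> d \<ge> \<eta> * (d \<bullet> d)"
    and tr: "\<And>x. a x \<bullet> mat 1 \<le> C" and b: "\<And>x. norm (b x) \<le> C"
    and T: "T > 0" and r: "r > 0"
  obtains k where "k > 0"
    "\<And>w \<epsilon> t0 x0. continuous_on ({t0..t0 + T} \<times> UNIV) (\<lambda>(t, x). w t x) \<Longrightarrow>
      (\<And>t x. t \<in> {t0..t0 + T} \<Longrightarrow> w t x \<ge> 0) \<Longrightarrow>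
      (\<And>t x. t0 < t \<Longrightarrow> t \<le> t0 + T \<Longrightarrow>
         \<exists>\<alpha> p H. jet w t x \<alpha> p H \<and> \<alpha> \<ge> a x \<bullet> H + b x \<bullet> p - K * w t x) \<Longrightarrow>
      \<epsilon> > 0 \<Longrightarrow> (\<And>x. dist x x0 \<le> r \<Longrightarrow> w t0 x \<ge> \<epsilon>) \<Longrightarrow> k * \<epsilon> \<le> w (t0 + T) (x0 + h)"
proof -
  define V where "V = (1 / T) *\<^sub>R h"
  \<comment> \<open>Collects the terms linear in R = r^2 - |y|^2: transport, trace, drift, and the
    loss 8 \<eta> R in the bound 8 \<eta> (r^2 - R) for 8 y . a y.\<close>
  define P where "P = 4 * r * norm V + 4 * C + 4 * C * r + 8 * \<eta>"
  \<comment> \<open>Makes the quadratic (l - K) R^2 - P R + 8 \<eta> r^2 a perfect square up to a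
    positive factor, hence nonnegative for all R. Neither \<open>P\<close> nor \<open>l\<close>
    involves \<open>w\<close>, \<open>t0\<close> or \<open>x0\<close>, so one \<open>k\<close>
    serves them all.\<close>
  define l where "l = K + P\<^sup>2 / (32 * \<eta> * r\<^sup>2)"
  have C: "C \<ge> 0" using order_trans[OF norm_ge_zero b] .
  have main: "exp (- l * T) * \<epsilon> \<le> w (t0 + T) (x0 + h)"
    if cont: "continuous_on ({t0..t0 + T} \<times> UNIV) (\<lambda>(t, x). w t x)"
      and nn: "\<And>t x. t \<in> {t0..t0 + T} \<Longrightarrow> w t x \<ge> 0"
      and sup: "\<And>t x. t0 < t \<Longrightarrow> t \<le> t0 + T \<Longrightarrow>
         \<exists>\<alpha> p H. jet w t x \<alpha> p H \<and> \<alpha> \<ge> a x \<bullet> H + b x \<bullet> p - K * w t x"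
      and \<epsilon>: "\<epsilon> > 0" and init: "\<And>x. dist x x0 \<le> r \<Longrightarrow> w t0 x \<ge> \<epsilon>"
    for w \<epsilon> t0 and x0 :: "real^'n"
  proof -
    define y where "y t x = x - x0 - (t - t0) *\<^sub>R V" for t x
    define \<rho> where "\<rho> t x = r\<^sup>2 - y t x \<bullet> y t x" for t x
    \<comment> \<open>Division by \<open>r^4\<close>, the maximum of the squared bump, makes the
      initial height exactly \<open>\<epsilon>\<close>.\<close>
    define \<theta> where "\<theta> t = \<epsilon> / r^4 * exp (- l * (t - t0))" for t
    define g where "g t x = \<theta> t * (max 0 (\<rho> t x))\<^sup>2" for t x
    have \<theta>pos: "\<theta> t > 0" for t using \<epsilon> r by (simp add: \<theta>_def)
    have \<rho>le: "\<rho> t x \<le> r\<^sup>2" for t x by (simp add: \<rho>_def)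
    have mle: "(max 0 (\<rho> t x))\<^sup>2 \<le> r^4" for t x
      using power_mono[of "max 0 (\<rho> t x)" "r\<^sup>2" 2] \<rho>le[of t x] by simp
    have hle: "g t x \<le> \<epsilon> * exp (- l * (t - t0))" for t x
      using mult_left_mono[OF mle[of t x], of "\<theta> t"] \<theta>pos[of t] r by (simp add: g_def \<theta>_def)
    have "g (t0 + T) (x0 + h) - w (t0 + T) (x0 + h) \<le> 0 * exp (- K * (t0 + T - t0))"
    proof (rule max_principle[of a C b t0 "t0 + T" "\<lambda>t x. g t x - w t x" "\<epsilon> * exp (\<bar>l\<bar> * T)" 0 "- K"])
      show "(a x *v d) \<bullet> d \<ge> 0" for x d
        using ell[of d x] \<eta> by (meson inner_ge_zero less_imp_le mult_nonneg_nonneg order_trans)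
      have "continuous_on ({t0..t0 + T} \<times> UNIV) (\<lambda>q. w (fst q) (snd q))"
        using cont by (simp add: case_prod_unfold)
      then show "continuous_on ({t0..t0 + T} \<times> UNIV) (\<lambda>(t, x). g t x - w t x)"
        unfolding g_def \<theta>_def \<rho>_def y_def case_prod_unfold by (intro continuous_intros)
      show "g t x - w t x \<le> \<epsilon> * exp (\<bar>l\<bar> * T)" if "t \<in> {t0..t0 + T}" for t x
      proof -
        have "- l * (t - t0) \<le> \<bar>l\<bar> * T" using that by (intro mult_mono) auto
        then have "\<epsilon> * exp (- l * (t - t0)) \<le> \<epsilon> * exp (\<bar>l\<bar> * T)" using \<epsilon> by simp
        with hle[of t x] nn[OF that, of x] show ?thesis by linarith
      qed
      show "g t0 x - w t0 x \<le> 0" for x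
      proof (cases "dist x x0 \<le> r")
        case True
        then show ?thesis using init[OF True] hle[of t0 x] by simp
      next
        case False
        then have "r\<^sup>2 \<le> (dist x x0)\<^sup>2" using r by (intro power_mono) auto
        then have "\<rho> t0 x \<le> 0" by (simp add: \<rho>_def y_def dist_norm power2_norm_eq_inner)
        then have "g t0 x = 0" by (simp add: g_def max_def)
        then show ?thesis using nn[of t0 x] T by simp
      qed
      show "\<exists>\<alpha> p H. jet (\<lambda>t x. g t x - w t x) t x \<alpha> p H \<and>
          \<alpha> \<le> a x \<bullet> H + b x \<bullet> p + (- K) * (g t x - w t x)"
        if t: "t0 < t" "t \<le> t0 + T" and pos: "g t x - w t x > 0" for t x
      proof -
        \<comment> \<open>The edge of the truncation is never met: since \<open>w \<ge> 0\<close>, a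
          positive difference forces \<open>\<rho> > 0\<close>.\<close>
        have "g t x > 0" using pos nn[of t x] t by simp
        then have \<rho>pos: "\<rho> t x > 0"
          by (rule contrapos_pp) (simp add: g_def max_def)
        obtain \<beta> q G where J: "jet w t x \<beta> q G" and ge: "\<beta> \<ge> a x \<bullet> G + b x \<bullet> q - K * w t x"
          using sup[OF t] by blast
        define Y where "Y = y t x"
        define R where "R = \<rho> t x"
        define H where "H = 8 *\<^sub>R (\<chi> i j. Y $ i * Y $ j) - (4 * R) *\<^sub>R (mat 1 :: real^'n^'n)"
        have d\<theta>: "(\<theta> has_real_derivative - l * \<theta> t) (at t)"
        proof -
          have "((\<lambda>t. exp (- l * (t - t0))) has_real_derivative - l * exp (- l * (t - t0))) (at t)"
            by (auto intro!: derivative_eq_intros)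
          from DERIV_cmult[OF this, of "\<epsilon> / r^4"] show ?thesis
            by (simp add: \<theta>_def[abs_def] mult_ac)
        qed
        have "jet (\<lambda>t x. \<theta> t * (\<rho> t x)\<^sup>2) t x (- l * \<theta> t * R\<^sup>2 + \<theta> t * (4 * R * (Y \<bullet> V)))
            (\<theta> t *\<^sub>R (- (4 * R) *\<^sub>R Y)) (\<theta> t *\<^sub>R H)"
          using jet_mult_time[OF jet_bump[of r x0 t0 V t x] d\<theta>]
          by (simp add: \<rho>_def y_def Y_def R_def H_def)
        then have Jh: "jet g t x (- l * \<theta> t * R\<^sup>2 + \<theta> t * (4 * R * (Y \<bullet> V)))
            (\<theta> t *\<^sub>R (- (4 * R) *\<^sub>R Y)) (\<theta> t *\<^sub>R H)"
        proof (rule jet_cong_local)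
          have "continuous_on UNIV (\<lambda>q. \<rho> (fst q) (snd q))"
            unfolding \<rho>_def y_def by (intro continuous_intros)
          then show "open {q. \<rho> (fst q) (snd q) > 0}"
            by (intro open_Collect_less continuous_intros)
        qed (use \<rho>pos in \<open>auto simp: g_def\<close>)
        have YY: "Y \<bullet> Y = r\<^sup>2 - R" by (simp add: Y_def R_def \<rho>_def)
        have "(norm Y)\<^sup>2 \<le> r\<^sup>2" using YY \<rho>pos by (simp add: power2_norm_eq_inner R_def)
        then have nY: "norm Y \<le> r" using r by (simp add: power2_le_iff_abs_le)
        have YV: "Y \<bullet> V \<le> r * norm V"
          using norm_cauchy_schwarz[of Y V] mult_right_mono[OF nY, of "norm V"] by simp
        have bY: "b x \<bullet> Y \<le> C * r"
          using norm_cauchy_schwarz[of "b x" Y] mult_mono[OF b[of x] nY C] by simp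
        have aH: "a x \<bullet> H = 8 * ((a x *v Y) \<bullet> Y) - 4 * R * (a x \<bullet> mat 1)"
          by (simp add: H_def inner_diff_right inner_outer_product)
        have R: "R > 0" using \<rho>pos by (simp add: R_def)
        have key: "- l * R\<^sup>2 + 4 * R * (Y \<bullet> V) \<le> a x \<bullet> H + b x \<bullet> (- (4 * R) *\<^sub>R Y) - K * R\<^sup>2"
        proof -
          have "4 * R * (Y \<bullet> V) + 4 * R * (a x \<bullet> mat 1) + 4 * R * (b x \<bullet> Y)
              = 4 * R * (Y \<bullet> V + a x \<bullet> mat 1 + b x \<bullet> Y)" by (simp add: algebra_simps)
          also have "\<dots> \<le> 4 * R * (r * norm V + C + C * r)"
            using YV bY tr[of x] R by (intro mult_left_mono) auto
          finally have 1: "4 * R * (Y \<bullet> V) + 4 * R * (a x \<bullet> mat 1) + 4 * R * (b x \<bullet> Y)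
              \<le> 4 * R * (r * norm V + C + C * r)" .
          have 2: "(a x *v Y) \<bullet> Y \<ge> \<eta> * (r\<^sup>2 - R)" using ell[of Y x] by (simp add: YY)
          have "(P\<^sup>2 / (32 * \<eta> * r\<^sup>2)) * R\<^sup>2 - P * R + 8 * \<eta> * r\<^sup>2
              = (P * R - 16 * \<eta> * r\<^sup>2)\<^sup>2 / (32 * \<eta> * r\<^sup>2)"
            using \<eta> r by (simp add: field_simps power2_eq_square)
          also have "\<dots> \<ge> 0" using \<eta> by simp
          finally have 3: "(l - K) * R\<^sup>2 - P * R + 8 * \<eta> * r\<^sup>2 \<ge> 0" by (simp add: l_def)
          have "P * R = 4 * R * (r * norm V + C + C * r) + 8 * \<eta> * R" by (simp add: P_def algebra_simps)
          with 1 2 3 show ?thesis unfolding aH by (simp add: algebra_simps)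
        qed
        have "jet (\<lambda>t x. g t x - w t x) t x (- l * \<theta> t * R\<^sup>2 + \<theta> t * (4 * R * (Y \<bullet> V)) - \<beta>)
            (\<theta> t *\<^sub>R (- (4 * R) *\<^sub>R Y) - q) (\<theta> t *\<^sub>R H - G)"
          by (rule jet_diff[OF Jh J])
        moreover have "- l * \<theta> t * R\<^sup>2 + \<theta> t * (4 * R * (Y \<bullet> V)) - \<beta>
            \<le> a x \<bullet> (\<theta> t *\<^sub>R H - G) + b x \<bullet> (\<theta> t *\<^sub>R (- (4 * R) *\<^sub>R Y) - q) + (- K) * (g t x - w t x)"
        proof -
          have "g t x = \<theta> t * R\<^sup>2" using R by (simp add: g_def R_def)
          moreover have "\<theta> t * (- l * R\<^sup>2 + 4 * R * (Y \<bullet> V))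
              \<le> \<theta> t * (a x \<bullet> H + b x \<bullet> (- (4 * R) *\<^sub>R Y) - K * R\<^sup>2)"
            using key \<theta>pos[of t] by (intro mult_left_mono) auto
          ultimately show ?thesis using ge by (simp add: inner_diff_right algebra_simps)
        qed
        ultimately show ?thesis by blast
      qed
    qed (use tr b T in auto)
    moreover have "g (t0 + T) (x0 + h) = exp (- l * T) * \<epsilon>"
    proof -
      have "y (t0 + T) (x0 + h) = 0" using T by (simp add: y_def V_def)
      then show ?thesis using r by (simp add: g_def \<theta>_def \<rho>_def)
    qed
    ultimately show ?thesis by simp
  qed
  show thesis
    by (rule that[of "exp (- l * T)"]) (use main in auto)
qed

section \<open>From partial derivatives to jets of solutions\<close>

lemma Ck_on_imp_continuous_on:
  assumes "Ck_on k S g"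
  shows "continuous_on S g"
proof (cases k)
  case (Suc m)
  with assms obtain D where "\<forall>x\<in>S. (g has_derivative D x) (at x within S)" by auto
  then show ?thesis by (auto intro!: has_derivative_continuous_on)
qed (use assms in auto)

lemma Ck_on_imp_differentiable:
  assumes "Ck_on (Suc k) UNIV g"
  shows "g differentiable (at x)"
  using assms by (auto simp: differentiable_def)

text \<open>\<open>partial_deriv\<close> rests on \<open>deriv\<close>, whose value is unspecified
  where no derivative exists; total differentiability gives the formal gradient its meaning and
  opens the way to the chain rule.\<close>

lemma has_derivative_grad:
  assumes "g differentiable (at x)"
  shows "(g has_derivative (\<lambda>d. grad g x \<bullet> d)) (at x)"
proof -
  obtain D where D: "(g has_derivative D) (at x)" using assms by (auto simp: differentiable_def)
  have lin: "linear D" using has_derivative_linear[OF D] .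
  have ax: "D (axis i 1) = partial_deriv i g x" for i
  proof -
    have "((\<lambda>s. g (x + s *\<^sub>R axis i 1)) has_derivative (\<lambda>s. D (s *\<^sub>R axis i 1))) (at 0)"
      using D by (intro has_derivative_compose[of "\<lambda>s. x + s *\<^sub>R axis i 1" _ 0 UNIV g D])
        (auto intro!: derivative_eq_intros)
    then have "((\<lambda>s. g (x + s *\<^sub>R axis i 1)) has_real_derivative D (axis i 1)) (at 0)"
      by (simp add: has_field_derivative_def linear_cmul[OF lin] mult_commute_abs)
    then show ?thesis by (simp add: partial_deriv_def DERIV_imp_deriv)
  qed
  have "D d = grad g x \<bullet> d" for d
  proof -
    have "D d = D (\<Sum>i\<in>UNIV. (d $ i) *\<^sub>R axis i 1)"
      using basis_expansion[of d] by (simp add: scalar_mult_eq_scaleR)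
    also have "\<dots> = (\<Sum>i\<in>UNIV. d $ i * partial_deriv i g x)"
      by (simp add: linear_sum[OF lin] linear_cmul[OF lin] ax)
    finally show ?thesis by (simp add: inner_vec_def grad_def mult.commute)
  qed
  then have "D = (\<lambda>d. grad g x \<bullet> d)" by (rule ext)
  with D show ?thesis by simp
qed

lemma line_derivative:
  assumes "g differentiable (at (x + s *\<^sub>R d))"
  shows "((\<lambda>s. g (x + s *\<^sub>R d)) has_real_derivative grad g (x + s *\<^sub>R d) \<bullet> d) (at s)"
proof -
  have "((\<lambda>s. g (x + s *\<^sub>R d)) has_derivative (\<lambda>r. grad g (x + s *\<^sub>R d) \<bullet> (r *\<^sub>R d))) (at s)"
    using has_derivative_grad[OF assms]
    by (intro has_derivative_compose[of "\<lambda>s. x + s *\<^sub>R d" _ s UNIV g])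
      (auto intro!: derivative_eq_intros)
  then show ?thesis by (simp add: has_field_derivative_def mult_commute_abs)
qed

lemma partial_derivative_line:
  assumes "g differentiable (at (x + s *\<^sub>R axis i 1))"
  shows "((\<lambda>s. g (x + s *\<^sub>R axis i 1)) has_real_derivative partial_deriv i g (x + s *\<^sub>R axis i 1)) (at s)"
  using line_derivative[OF assms] by (simp add: inner_axis grad_def)

lemma partial_derivI:
  assumes "(g has_derivative D) (at x)"
  shows "partial_deriv i g x = D (axis i 1)"
proof -
  have "g differentiable (at x)" using assms by (auto simp: differentiable_def)
  from has_derivative_unique[OF assms has_derivative_grad[OF this]]
  show ?thesis by (simp add: inner_axis grad_def)
qed

text \<open>The mean value theorem, in the first variable and then in the second. The left side of
  the equation is symmetric in the two variables, which is what Schwarz's theorem exploits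
  next.\<close>

lemma second_difference:
  fixes F :: "real \<Rightarrow> real \<Rightarrow> real"
  assumes "\<And>s t. ((\<lambda>s. F s t) has_real_derivative F1 s t) (at s)"
    and "\<And>s t. ((\<lambda>t. F1 s t) has_real_derivative F12 s t) (at t)" and h: "h > 0"
  obtains \<sigma> \<tau> where "0 < \<sigma>" "\<sigma> < h" "0 < \<tau>" "\<tau> < h" "F h h - F h 0 - F 0 h + F 0 0 = h\<^sup>2 * F12 \<sigma> \<tau>"
proof -
  have "((\<lambda>s. F s h - F s 0) has_real_derivative F1 s h - F1 s 0) (at s)" for s
    using assms(1) by (intro DERIV_diff)
  from MVT2[OF h this] obtain \<sigma> where \<sigma>: "0 < \<sigma>" "\<sigma> < h"
      "(F h h - F h 0) - (F 0 h - F 0 0) = (h - 0) * (F1 \<sigma> h - F1 \<sigma> 0)"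
    by blast
  from MVT2[OF h assms(2)] obtain \<tau> where \<tau>: "0 < \<tau>" "\<tau> < h"
      "F1 \<sigma> h - F1 \<sigma> 0 = (h - 0) * F12 \<sigma> \<tau>"
    by blast
  show thesis
    by (rule that[OF \<sigma>(1,2) \<tau>(1,2)]) (use \<sigma>(3) \<tau>(3) in \<open>simp add: power2_eq_square algebra_simps\<close>)
qed

text \<open>Schwarz's theorem: one second difference equals \<open>h\<^sup>2\<close> times either
  mixed derivative at points close to the origin, and continuity there forces a common
  value.\<close>

lemma mixed_derivatives_eq:
  fixes F :: "real \<Rightarrow> real \<Rightarrow> real"
  assumes "\<And>s t. ((\<lambda>s. F s t) has_real_derivative F1 s t) (at s)"
    and "\<And>s t. ((\<lambda>t. F1 s t) has_real_derivative F12 s t) (at t)"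
    and "\<And>s t. ((\<lambda>t. F s t) has_real_derivative F2 s t) (at t)"
    and "\<And>s t. ((\<lambda>s. F2 s t) has_real_derivative F21 s t) (at s)"
    and c12: "isCont (\<lambda>(s, t). F12 s t) (0, 0)" and c21: "isCont (\<lambda>(s, t). F21 s t) (0, 0)"
  shows "F12 0 0 = F21 0 0"
proof (rule ccontr)
  assume ne: "F12 0 0 \<noteq> F21 0 0"
  define e where "e = \<bar>F12 0 0 - F21 0 0\<bar> / 2"
  have e: "e > 0" using ne by (simp add: e_def)
  obtain d1 where d1: "d1 > 0" "\<And>p. dist p (0, 0) < d1 \<Longrightarrow> dist ((\<lambda>(s, t). F12 s t) p) (F12 0 0) < e"
    using c12 e unfolding continuous_at_eps_delta by fastforce
  obtain d2 where d2: "d2 > 0" "\<And>p. dist p (0, 0) < d2 \<Longrightarrow> dist ((\<lambda>(s, t). F21 s t) p) (F21 0 0) < e"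
    using c21 e unfolding continuous_at_eps_delta by fastforce
  define h where "h = min d1 d2 / 2"
  have h: "h > 0" "2 * h \<le> d1" "2 * h \<le> d2" using d1(1) d2(1) by (auto simp: h_def)
  have near: "dist (s, t) (0, 0) < 2 * h" if "0 < s" "s < h" "0 < t" "t < h" for s t :: real
    using sqrt_sum_squares_le_sum_abs[of s t] that by (simp add: dist_norm norm_Pair)
  obtain \<sigma> \<tau> where 1: "0 < \<sigma>" "\<sigma> < h" "0 < \<tau>" "\<tau> < h" "F h h - F h 0 - F 0 h + F 0 0 = h\<^sup>2 * F12 \<sigma> \<tau>"
    by (rule second_difference[OF assms(1,2) h(1)])
  obtain \<tau>' \<sigma>' where 2: "0 < \<tau>'" "\<tau>' < h" "0 < \<sigma>'" "\<sigma>' < h"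
      "F h h - F 0 h - F h 0 + F 0 0 = h\<^sup>2 * F21 \<sigma>' \<tau>'"
    by (rule second_difference[of "\<lambda>t s. F s t" "\<lambda>t s. F2 s t" "\<lambda>t s. F21 s t", OF assms(3,4) h(1)])
  have "h\<^sup>2 * F12 \<sigma> \<tau> = h\<^sup>2 * F21 \<sigma>' \<tau>'" using 1(5) 2(5) by linarith
  then have "F12 \<sigma> \<tau> = F21 \<sigma>' \<tau>'" using h(1) by simp
  moreover have "\<bar>F12 \<sigma> \<tau> - F12 0 0\<bar> < e"
    using d1(2)[of "(\<sigma>, \<tau>)"] near[OF 1(1-4)] h by (simp add: dist_real_def)
  moreover have "\<bar>F21 \<sigma>' \<tau>' - F21 0 0\<bar> < e"
    using d2(2)[of "(\<sigma>', \<tau>')"] near[OF 2(3,4,1,2)] h by (simp add: dist_real_def)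
  ultimately show False by (simp add: e_def abs_if split: if_splits)
qed

definition hessian :: "(real^'n \<Rightarrow> real) \<Rightarrow> real^'n \<Rightarrow> real^'n^'n" where
  "hessian g x = (\<chi> i j. partial_deriv j (partial_deriv i g) x)"

lemma hessian_symmetric:
  assumes d: "\<And>x. g differentiable (at x)" and d2: "\<And>i x. partial_deriv i g differentiable (at x)"
    and c: "\<And>i j. continuous_on UNIV (partial_deriv j (partial_deriv i g))"
  shows "partial_deriv j (partial_deriv i g) x = partial_deriv i (partial_deriv j g) x"
proof -
  let ?p = "\<lambda>s t. x + s *\<^sub>R axis i 1 + t *\<^sub>R axis j 1"
  have p': "?p s t = x + t *\<^sub>R axis j 1 + s *\<^sub>R axis i 1" for s t by simp
  have D1: "((\<lambda>s. h (?p s t)) has_real_derivative partial_deriv i h (?p s t)) (at s)"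
    if "\<And>x. h differentiable (at x)" for h s t
    unfolding p' by (rule partial_derivative_line) (rule that)
  have D2: "((\<lambda>t. h (?p s t)) has_real_derivative partial_deriv j h (?p s t)) (at t)"
    if "\<And>x. h differentiable (at x)" for h s t
    by (rule partial_derivative_line) (rule that)
  have cont: "isCont (\<lambda>(s, t). h (?p s t)) (0, 0)" if "continuous_on UNIV h" for h :: "_ \<Rightarrow> real"
  proof -
    have "continuous_on UNIV (\<lambda>q. h (?p (fst q) (snd q)))"
      by (rule continuous_on_compose2[OF that]) (auto intro!: continuous_intros)
    then show ?thesis by (simp add: continuous_on_eq_continuous_at case_prod_unfold)
  qed
  have "partial_deriv j (partial_deriv i g) (?p 0 0) = partial_deriv i (partial_deriv j g) (?p 0 0)"
    by (rule mixed_derivatives_eq[of "\<lambda>s t. g (?p s t)" "\<lambda>s t. partial_deriv i g (?p s t)"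
        "\<lambda>s t. partial_deriv j (partial_deriv i g) (?p s t)" "\<lambda>s t. partial_deriv j g (?p s t)"
        "\<lambda>s t. partial_deriv i (partial_deriv j g) (?p s t)"])
      (intro D1 D2 d d2 cont c)+
  then show ?thesis by simp
qed

lemma jet_of_C12:
  fixes u :: "real \<Rightarrow> real^'n \<Rightarrow> real"
  assumes u: "C12 u"
  shows "jet u t x (deriv (\<lambda>s. u s x) t) (grad (u t) x) (hessian (u t) x)"
  unfolding jet_def
proof (intro conjI allI)
  have d: "\<And>x. u t differentiable (at x)" and d2: "\<And>i x. partial_deriv i (u t) differentiable (at x)"
    using u by (auto simp: C12_def)
  have c2: "continuous_on UNIV (partial_deriv j (partial_deriv i (u t)))" for i j
  proof -
    have "continuous_on UNIV (\<lambda>(t, x). partial_deriv j (partial_deriv i (u t)) x)"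
      using u by (simp add: C12_def)
    moreover have "continuous_on UNIV (\<lambda>x. (t, x) :: real \<times> (real^'n))" by (intro continuous_intros)
    ultimately show ?thesis using continuous_on_compose2[of UNIV _ UNIV "\<lambda>x. (t, x)"] by fastforce
  qed
  show "((\<lambda>s. u s x) has_real_derivative deriv (\<lambda>s. u s x) t) (at t)"
    using u by (simp add: C12_def DERIV_deriv_iff_real_differentiable)
  show "transpose (hessian (u t) x) = hessian (u t) x"
    using hessian_symmetric[of "u t", OF d d2 c2] by (simp add: transpose_def hessian_def vec_eq_iff)
  fix e
  show "\<exists>g. (\<forall>\<^sub>F s in nhds 0. ((\<lambda>s. u t (x + s *\<^sub>R e)) has_real_derivative g s) (at s)) \<and>
        g 0 = grad (u t) x \<bullet> e \<and> (g has_real_derivative (hessian (u t) x *v e) \<bullet> e) (at 0)"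
  proof (intro exI[of _ "\<lambda>s. grad (u t) (x + s *\<^sub>R e) \<bullet> e"] conjI always_eventually allI)
    show "((\<lambda>s. u t (x + s *\<^sub>R e)) has_real_derivative grad (u t) (x + s *\<^sub>R e) \<bullet> e) (at s)" for s
      by (rule line_derivative[OF d])
    have "((\<lambda>s. \<Sum>i\<in>UNIV. partial_deriv i (u t) (x + s *\<^sub>R e) * e $ i) has_real_derivative
        (\<Sum>i\<in>UNIV. (grad (partial_deriv i (u t)) (x + 0 *\<^sub>R e) \<bullet> e) * e $ i)) (at 0)"
      by (intro DERIV_sum DERIV_cmult_right line_derivative d2)
    then show "((\<lambda>s. grad (u t) (x + s *\<^sub>R e) \<bullet> e) has_real_derivative (hessian (u t) x *v e) \<bullet> e) (at 0)"
      by (simp add: inner_vec_def grad_def hessian_def matrix_vector_mult_def)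
  qed simp
qed

lemma differentiable_matrix_entry:
  fixes A :: "real^'n \<Rightarrow> real^'n^'n"
  assumes "A differentiable (at x)"
  shows "(\<lambda>z. A z $ i $ j) differentiable (at x)"
proof -
  obtain D where "(A has_derivative D) (at x)" using assms by (auto simp: differentiable_def)
  then have "((\<lambda>z. A z $ i $ j) has_derivative (\<lambda>d. D d $ i $ j)) (at x)"
    by (intro bounded_linear.has_derivative[OF bounded_linear_vec_nth])
  then show ?thesis by (auto simp: differentiable_def)
qed

lemma partial_deriv_rescale:
  assumes "g differentiable (at (x /\<^sub>R L))"
  shows "(\<lambda>z. g (z /\<^sub>R L)) differentiable (at x)"
    and "partial_deriv i (\<lambda>z. g (z /\<^sub>R L)) x = partial_deriv i g (x /\<^sub>R L) / L"
proof -
  have D: "((\<lambda>z. g (z /\<^sub>R L)) has_derivative (\<lambda>d. grad g (x /\<^sub>R L) \<bullet> (d /\<^sub>R L))) (at x)"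
    using has_derivative_grad[OF assms]
    by (intro has_derivative_compose[of "\<lambda>z. z /\<^sub>R L" _ x UNIV g]) (auto intro!: derivative_eq_intros)
  then show "(\<lambda>z. g (z /\<^sub>R L)) differentiable (at x)" by (auto simp: differentiable_def)
  show "partial_deriv i (\<lambda>z. g (z /\<^sub>R L)) x = partial_deriv i g (x /\<^sub>R L) / L"
    using partial_derivI[OF D, of i] by (simp add: inner_axis grad_def divide_inverse)
qed

text \<open>First-order coefficient once the divergence is expanded: \<open>B\<close> plus the
  divergences of the columns of \<open>A\<close>, with 1 / \<open>L\<close> from the chain
  rule.\<close>

definition drift :: "(real^'n \<Rightarrow> real^'n^'n) \<Rightarrow> (real^'n \<Rightarrow> real^'n) \<Rightarrow> real \<Rightarrow> real^'n \<Rightarrow> real^'n" where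
  "drift A B L x = B (x /\<^sub>R L) + (\<chi> j. \<Sum>i\<in>UNIV. partial_deriv i (\<lambda>z. A z $ i $ j) (x /\<^sub>R L) / L)"

text \<open>The product rule pairs \<open>A\<close> with the transposed Hessian. As \<open>A\<close>
  need not be symmetric, it is the symmetry of the Hessian that removes the transpose.\<close>

lemma divergence_expand:
  assumes A: "\<And>x. A differentiable (at x)"
    and d2: "\<And>i. partial_deriv i g differentiable (at x)"
    and sym: "transpose (hessian g x) = hessian g x"
  shows "divergence (\<lambda>z. A (z /\<^sub>R L) *v grad g z) x + B (x /\<^sub>R L) \<bullet> grad g x
    = A (x /\<^sub>R L) \<bullet> hessian g x + drift A B L x \<bullet> grad g x"
proof -
  have "partial_deriv i (\<lambda>z. (A (z /\<^sub>R L) *v grad g z) $ i) x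
     = (\<Sum>j\<in>UNIV. partial_deriv i (\<lambda>z. A z $ i $ j) (x /\<^sub>R L) / L * partial_deriv j g x
          + A (x /\<^sub>R L) $ i $ j * partial_deriv i (partial_deriv j g) x)" for i
  proof -
    note scaled = partial_deriv_rescale[OF differentiable_matrix_entry[OF A]]
    have "((\<lambda>s. A ((x + s *\<^sub>R axis i 1) /\<^sub>R L) $ i $ j) has_real_derivative
        partial_deriv i (\<lambda>z. A z $ i $ j) (x /\<^sub>R L) / L) (at 0)" for j
      using partial_derivative_line[of "\<lambda>z. A (z /\<^sub>R L) $ i $ j" x 0 i] scaled by simp
    moreover have "((\<lambda>s. partial_deriv j g (x + s *\<^sub>R axis i 1)) has_real_derivative
        partial_deriv i (partial_deriv j g) x) (at 0)" for j
      using partial_derivative_line[of "partial_deriv j g" x 0 i] d2 by simp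
    ultimately have "((\<lambda>s. \<Sum>j\<in>UNIV. A ((x + s *\<^sub>R axis i 1) /\<^sub>R L) $ i $ j * partial_deriv j g (x + s *\<^sub>R axis i 1))
       has_real_derivative (\<Sum>j\<in>UNIV. partial_deriv i (\<lambda>z. A z $ i $ j) (x /\<^sub>R L) / L * partial_deriv j g x
          + A (x /\<^sub>R L) $ i $ j * partial_deriv i (partial_deriv j g) x)) (at 0)"
      by (intro DERIV_sum) (auto intro!: derivative_eq_intros)
    then show ?thesis
      unfolding partial_deriv_def[of i "\<lambda>z. (A (z /\<^sub>R L) *v grad g z) $ i"]
      by (simp add: matrix_vector_mult_def grad_def DERIV_imp_deriv)
  qed
  then have "divergence (\<lambda>z. A (z /\<^sub>R L) *v grad g z) x =
     (\<Sum>i\<in>UNIV. \<Sum>j\<in>UNIV. partial_deriv i (\<lambda>z. A z $ i $ j) (x /\<^sub>R L) / L * partial_deriv j g x)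
     + (\<Sum>i\<in>UNIV. \<Sum>j\<in>UNIV. A (x /\<^sub>R L) $ i $ j * partial_deriv i (partial_deriv j g) x)"
    by (simp add: divergence_def sum.distrib)
  also have "(\<Sum>i\<in>UNIV. \<Sum>j\<in>UNIV. A (x /\<^sub>R L) $ i $ j * partial_deriv i (partial_deriv j g) x)
      = A (x /\<^sub>R L) \<bullet> transpose (hessian g x)"
    by (simp add: inner_vec_def transpose_def hessian_def)
  also have "(\<Sum>i\<in>UNIV. \<Sum>j\<in>UNIV. partial_deriv i (\<lambda>z. A z $ i $ j) (x /\<^sub>R L) / L * partial_deriv j g x)
      = (drift A B L x - B (x /\<^sub>R L)) \<bullet> grad g x"
    by (subst sum.swap) (simp add: drift_def inner_vec_def grad_def sum_distrib_right)
  finally show ?thesis by (simp add: sym inner_diff_left)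
qed

text \<open>The equation at a single point in nondivergence form, the shape that both maximum
  principles consume.\<close>

lemma solution_jet:
  assumes A: "\<And>x. A differentiable (at x)" and u: "entire_classical_solution A B f L u"
  obtains \<alpha> p H where "jet u t x \<alpha> p H"
    "\<alpha> = A (x /\<^sub>R L) \<bullet> H + drift A B L x \<bullet> p + f (x /\<^sub>R L) (u t x)"
proof
  have C: "C12 u" using u by (simp add: entire_classical_solution_def)
  show J: "jet u t x (deriv (\<lambda>s. u s x) t) (grad (u t) x) (hessian (u t) x)"
    by (rule jet_of_C12[OF C])
  have "transpose (hessian (u t) x) = hessian (u t) x" using J by (simp add: jet_def)
  from divergence_expand[OF A _ this, of L B] C
  show "deriv (\<lambda>s. u s x) t
      = A (x /\<^sub>R L) \<bullet> hessian (u t) x + drift A B L x \<bullet> grad (u t) x + f (x /\<^sub>R L) (u t x)"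
    using u by (simp add: entire_classical_solution_def C12_def)
qed

section \<open>Periodic functions and bounds on the coefficients\<close>

lemma periodic_reduce:
  fixes x :: "real^'n"
  obtains k :: "real^'n" where "\<forall>i. k $ i \<in> \<int>" "x - k \<in> cbox 0 1"
proof
  show "\<forall>i. ((\<chi> i. of_int \<lfloor>x $ i\<rfloor>) :: real^'n) $ i \<in> \<int>" by simp
  show "x - (\<chi> i. of_int \<lfloor>x $ i\<rfloor>) \<in> cbox 0 1"
    by (auto simp: mem_box_cart) (linarith+)
qed

lemma periodic_ZN_shift:
  assumes "periodic_ZN g" "\<forall>i. k $ i \<in> \<int>"
  shows "g (x - k) = g x" and "g (x + k) = g x"
proof -
  show *: "g (x + k) = g x" for x using assms by (simp add: periodic_ZN_def)
  show "g (x - k) = g x" using *[of "x - k"] by simp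
qed

lemma periodic_continuous_bounded:
  fixes g :: "real^'n \<Rightarrow> 'b::real_normed_vector"
  assumes "periodic_ZN g" "continuous_on UNIV g"
  obtains C where "\<And>x. norm (g x) \<le> C"
proof -
  have "compact (g ` cbox 0 1)"
    using assms(2) by (intro compact_continuous_image compact_cbox) (auto intro: continuous_on_subset)
  then have "bounded (g ` cbox 0 1)" by (rule compact_imp_bounded)
  then obtain C where C: "\<And>z. z \<in> cbox 0 1 \<Longrightarrow> norm (g z) \<le> C"
    unfolding bounded_iff by blast
  have "norm (g x) \<le> C" for x
  proof -
    obtain k :: "real^'n" where "\<forall>i. k $ i \<in> \<int>" "x - k \<in> cbox 0 1" by (rule periodic_reduce)
    then show ?thesis using C[of "x - k"] periodic_ZN_shift(1)[OF assms(1)] by simp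
  qed
  then show thesis by (rule that)
qed

text \<open>The drift is a continuous periodic function \<open>G\<close> evaluated at
  \<open>x /\<^sub>R L\<close>, so compactness of the unit cell bounds it; continuity of
  \<open>G\<close> comes from the first derivatives of \<open>A\<close>.\<close>

lemma coefficient_bounds:
  fixes A :: "real^'n \<Rightarrow> real^'n^'n"
  assumes A: "periodic_ZN A" "Ck_on 2 UNIV A" and B: "periodic_ZN B" "Ck_on 1 UNIV B"
  shows "\<exists>C. \<forall>x. A (x /\<^sub>R L) \<bullet> mat 1 \<le> C \<and> norm (drift A B L x) \<le> C"
proof -
  have "Ck_on (Suc 1) UNIV A" using A(2) by (simp add: numeral_2_eq_2)
  then obtain D where D: "\<And>x. (A has_derivative D x) (at x)" "\<And>b. b \<in> Basis \<Longrightarrow> Ck_on 1 UNIV (\<lambda>x. D x b)"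
    by auto
  have Ac: "continuous_on UNIV A" by (rule Ck_on_imp_continuous_on[OF A(2)])
  have Bc: "continuous_on UNIV B" by (rule Ck_on_imp_continuous_on[OF B(2)])
  have pd: "partial_deriv i (\<lambda>z. A z $ i $ j) y = D y (axis i 1) $ i $ j" for i j y
    by (rule partial_derivI) (intro bounded_linear.has_derivative[OF bounded_linear_vec_nth] D)
  have pc: "continuous_on UNIV (\<lambda>y. partial_deriv i (\<lambda>z. A z $ i $ j) y)" for i j
    unfolding pd using Ck_on_imp_continuous_on[OF D(2)[of "axis i 1"]]
    by (intro continuous_intros) (auto simp: axis_in_Basis_iff)
  have pp: "periodic_ZN (\<lambda>y. partial_deriv i (\<lambda>z. A z $ i $ j) y)" for i j
    unfolding periodic_ZN_def
  proof (intro allI impI)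
    fix x k :: "real^'n" assume k: "\<forall>i. k $ i \<in> \<int>"
    have "A (x + k + s *\<^sub>R axis i 1) = A (x + s *\<^sub>R axis i 1)" for s
      using periodic_ZN_shift(2)[OF A(1) k, of "x + s *\<^sub>R axis i 1"] by (simp add: add_ac)
    then show "partial_deriv i (\<lambda>z. A z $ i $ j) (x + k) = partial_deriv i (\<lambda>z. A z $ i $ j) x"
      by (simp add: partial_deriv_def)
  qed
  define G where "G y = B y + (\<chi> j. \<Sum>i\<in>UNIV. partial_deriv i (\<lambda>z. A z $ i $ j) y / L)" for y
  have "continuous_on UNIV G" unfolding G_def divide_inverse
    by (intro continuous_intros Bc pc)
  moreover have "periodic_ZN G"
    using B(1) pp by (auto simp: periodic_ZN_def G_def)
  ultimately obtain C1 where C1: "\<And>x. norm (G x) \<le> C1" using periodic_continuous_bounded by blast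
  obtain C2 where C2: "\<And>x. norm (A x) \<le> C2" using periodic_continuous_bounded[OF A(1) Ac] by blast
  show ?thesis
  proof (intro exI[of _ "max C1 (C2 * norm (mat 1 :: real^'n^'n))"] allI conjI)
    show "A (x /\<^sub>R L) \<bullet> mat 1 \<le> max C1 (C2 * norm (mat 1 :: real^'n^'n))" for x
      using order_trans[OF norm_cauchy_schwarz mult_right_mono[OF C2]] by (simp add: le_max_iff_disj)
    show "norm (drift A B L x) \<le> max C1 (C2 * norm (mat 1 :: real^'n^'n))" for x
      using C1[of "x /\<^sub>R L"] by (simp add: drift_def G_def le_max_iff_disj)
  qed
qed

section \<open>The moving frame of a wave\<close>

context
  fixes L c s :: real and e :: "real^'n"
begin

text \<open>The argument of the profile seen from \<open>(t, x)\<close>. The free shift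
  \<open>s\<close> lets a single computation cover every translate.\<close>

definition wave_frame :: "real \<Rightarrow> real^'n \<Rightarrow> real \<times> (real^'n)" where
  "wave_frame t x = (x \<bullet> e - c * t + s, x /\<^sub>R L)"

lemma wave_frame_space:
  assumes "(G has_derivative D) (at (wave_frame t x))"
  shows "((\<lambda>x. G (wave_frame t x)) has_derivative (\<lambda>d. D (d \<bullet> e, d /\<^sub>R L))) (at x)"
  using assms
  by (intro has_derivative_compose[of "wave_frame t" _ x UNIV G D])
    (auto simp: wave_frame_def[abs_def] intro!: derivative_eq_intros)

lemma wave_frame_time:
  assumes "(G has_derivative D) (at (wave_frame t x))"
  shows "((\<lambda>t. G (wave_frame t x)) has_real_derivative - c * D (1, 0)) (at t)"
proof -
  have "((\<lambda>t. G (wave_frame t x)) has_derivative (\<lambda>r. D (- c * r, 0))) (at t)"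
    using assms
    by (intro has_derivative_compose[of "\<lambda>t. wave_frame t x" _ t UNIV G D])
      (auto simp: wave_frame_def[abs_def] intro!: derivative_eq_intros)
  moreover have "(\<lambda>r. D (- c * r, 0)) = (*) (- c * D (1, 0))"
  proof
    fix r show "D (- c * r, 0) = - c * D (1, 0) * r"
      using linear_cmul[OF has_derivative_linear[OF assms], of "- c * r" "(1, 0)"] by simp
  qed
  ultimately show ?thesis by (simp only: has_field_derivative_def)
qed

lemma continuous_on_wave_frame: "continuous_on UNIV (\<lambda>(t, x). wave_frame t x)"
  unfolding wave_frame_def case_prod_unfold by (intro continuous_intros)

lemma continuous_on_comp_wave_frame:
  assumes "continuous_on UNIV (G :: _ \<Rightarrow> real)"
  shows "continuous_on UNIV (\<lambda>(t, x). G (wave_frame t x))"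
  using continuous_on_compose2[OF assms continuous_on_wave_frame] by (simp add: case_prod_unfold)

text \<open>Counterpart of \<open>partial_deriv_wave_frame\<close>: a twisted derivative and the
  derivative of the pull-back are the same linear expression in \<open>D\<close>, which identifies
  the two forms of the equation.\<close>

lemma twisted_partial_eq:
  fixes g :: "real \<Rightarrow> real^'n \<Rightarrow> real"
  assumes "((\<lambda>(\<xi>, y). g \<xi> y) has_derivative D) (at (\<xi>, y))"
  shows "twisted_partial L e i g \<xi> y = e $ i * D (1, 0) + (1 / L) * D (0, axis i 1)"
    and "deriv (\<lambda>s. g s y) \<xi> = D (1, 0)"
proof -
  have lin: "linear D" by (rule has_derivative_linear[OF assms])
  have "((\<lambda>r. (\<lambda>(\<xi>, y). g \<xi> y) (r, y)) has_derivative (\<lambda>r. D (r, 0))) (at \<xi>)"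
    by (rule has_derivative_compose[of "\<lambda>r. (r, y)" _ \<xi> UNIV _ D])
      (use assms in \<open>auto intro!: derivative_eq_intros\<close>)
  moreover have "(\<lambda>r. D (r, 0)) = (*) (D (1, 0))"
  proof
    fix r show "D (r, 0) = D (1, 0) * r"
      using linear_cmul[OF lin, of r "(1, 0)"] by simp
  qed
  ultimately have "((\<lambda>r. g r y) has_real_derivative D (1, 0)) (at \<xi>)"
    by (simp add: has_field_derivative_def)
  then show 1: "deriv (\<lambda>s. g s y) \<xi> = D (1, 0)" by (rule DERIV_imp_deriv)
  have "((\<lambda>z. (\<lambda>(\<xi>, y). g \<xi> y) (\<xi>, z)) has_derivative (\<lambda>d. D (0, d))) (at y)"
    by (rule has_derivative_compose[of "\<lambda>z. (\<xi>, z)" _ y UNIV _ D])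
      (use assms in \<open>auto intro!: derivative_eq_intros\<close>)
  from partial_derivI[OF this] have "partial_deriv i (g \<xi>) y = D (0, axis i 1)" by simp
  with 1 show "twisted_partial L e i g \<xi> y = e $ i * D (1, 0) + (1 / L) * D (0, axis i 1)"
    by (simp add: twisted_partial_def)
qed

lemma partial_deriv_wave_frame:
  assumes "(G has_derivative D) (at (wave_frame t x))"
  shows "partial_deriv i (\<lambda>x. G (wave_frame t x)) x = e $ i * D (1, 0) + (1 / L) * D (0, axis i 1)"
proof -
  have lin: "linear D" by (rule has_derivative_linear[OF assms])
  have "(axis i 1 \<bullet> e, axis i 1 /\<^sub>R L) = (e $ i) *\<^sub>R (1, 0) + (1 / L) *\<^sub>R (0, axis i 1 :: real^'n)"
    by (simp add: inner_axis' divide_inverse)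
  moreover have "partial_deriv i (\<lambda>x. G (wave_frame t x)) x = D (axis i 1 \<bullet> e, axis i 1 /\<^sub>R L)"
    by (rule partial_derivI[OF wave_frame_space[OF assms]])
  ultimately show ?thesis
    by (simp only: linear_add[OF lin] linear_cmul[OF lin] real_scaleR_def)
qed

text \<open>The profile equation does not contain \<open>\<xi>\<close> explicitly, so it holds for
  every shift. When \<open>c = 0\<close>, a shift in \<open>\<xi>\<close> is not a time translation
  of the given solution, and the profile equation is what makes it a solution.\<close>

lemma profile_shift_solution:
  assumes prof: "classical_profile A B f L e \<phi> c"
    and A: "\<And>x. A differentiable (at x)"
  shows "entire_classical_solution A B f L (\<lambda>t x. \<phi> (x \<bullet> e - c * t + s) (x /\<^sub>R L))"
proof -
  define G where "G = (\<lambda>(\<xi>, y). \<phi> \<xi> y)"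
  have "Ck_on (Suc (Suc 0)) UNIV G" using prof by (simp add: classical_profile_def G_def numeral_2_eq_2)
  then obtain D where D: "\<And>p. (G has_derivative D p) (at p)"
      and D1: "\<And>b. b \<in> Basis \<Longrightarrow> Ck_on (Suc 0) UNIV (\<lambda>p. D p b)"
    unfolding Ck_on.simps(2)[of "Suc 0"] by blast
  have Basis: "(1, 0) \<in> (Basis :: (real \<times> (real^'n)) set)" "(0, axis i 1) \<in> (Basis :: (real \<times> (real^'n)) set)" for i
    by (auto simp: Basis_prod_def)
  define T where "T i p = e $ i * D p (1, 0) + (1 / L) * D p (0, axis i 1)" for i p
  have Tw: "twisted_partial L e i \<phi> \<xi> y = T i (\<xi>, y)" for i \<xi> y
    using twisted_partial_eq(1)[of \<phi> "D (\<xi>, y)" \<xi> y i] D[of "(\<xi>, y)"] by (simp add: T_def G_def)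
  have "\<exists>DT. (\<forall>p. (T i has_derivative DT p) (at p)) \<and> (\<forall>b\<in>Basis. continuous_on UNIV (\<lambda>p. DT p b))" for i
  proof -
    obtain E1 E2 where E1: "\<And>p. ((\<lambda>p. D p (1, 0)) has_derivative E1 p) (at p)"
        "\<And>b. b \<in> Basis \<Longrightarrow> continuous_on UNIV (\<lambda>p. E1 p b)"
      and E2: "\<And>p. ((\<lambda>p. D p (0, axis i 1)) has_derivative E2 p) (at p)"
        "\<And>b. b \<in> Basis \<Longrightarrow> continuous_on UNIV (\<lambda>p. E2 p b)"
      using D1[OF Basis(1)] D1[OF Basis(2), of i] unfolding Ck_on.simps by blast
    show ?thesis
    proof (intro exI[of _ "\<lambda>p d. e $ i * E1 p d + (1 / L) * E2 p d"] conjI ballI allI)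
      show "(T i has_derivative (\<lambda>d. e $ i * E1 p d + (1 / L) * E2 p d)) (at p)" for p
        unfolding T_def[abs_def]
        by (intro has_derivative_add has_derivative_mult_right E1 E2)
    qed (intro continuous_intros E1 E2)
  qed
  then obtain DT where DT: "\<And>i p. (T i has_derivative DT i p) (at p)"
      and DTc: "\<And>i b. b \<in> Basis \<Longrightarrow> continuous_on UNIV (\<lambda>p. DT i p b)"
    by metis
  have Gc: "continuous_on UNIV G" using D by (auto intro!: has_derivative_continuous_on)
  have Dc: "continuous_on UNIV (\<lambda>p. D p b)" if "b \<in> Basis" for b
    by (rule Ck_on_imp_continuous_on[OF D1[OF that]])
  have Tc: "continuous_on UNIV (T i)" for i using DT by (auto intro!: has_derivative_continuous_on)
  define U where "U t x = G (wave_frame t x)" for t x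
  have Ueq: "U = (\<lambda>t x. \<phi> (x \<bullet> e - c * t + s) (x /\<^sub>R L))"
    by (simp add: U_def[abs_def] G_def wave_frame_def)
  have Ut: "((\<lambda>t. U t x) has_real_derivative - c * D (wave_frame t x) (1, 0)) (at t)" for t x
    unfolding U_def by (rule wave_frame_time[OF D])
  then have Udt: "deriv (\<lambda>t. U t x) t = - c * D (wave_frame t x) (1, 0)" for t x
    by (rule DERIV_imp_deriv)
  have Ui: "partial_deriv i (U t) = (\<lambda>x. T i (wave_frame t x))" for i t
    unfolding U_def[abs_def] T_def by (intro ext partial_deriv_wave_frame D)
  have C12: "C12 U"
    unfolding C12_def
  proof (intro conjI allI)
    show "continuous_on UNIV (\<lambda>(t, x). U t x)"
      unfolding U_def by (rule continuous_on_comp_wave_frame[OF Gc])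
    show "(\<lambda>s. U s x) differentiable at t" for t x
      using Ut by (auto simp: real_differentiable_def)
    have "continuous_on UNIV (\<lambda>p. - c * D p (1, 0))" by (intro continuous_intros Dc Basis)
    then show "continuous_on UNIV (\<lambda>(t, x). deriv (\<lambda>s. U s x) t)"
      unfolding Udt by (rule continuous_on_comp_wave_frame)
    show "U t differentiable at x" for t x
      unfolding U_def[abs_def] using wave_frame_space[OF D] by (auto simp: differentiable_def)
    show "continuous_on UNIV (\<lambda>(t, x). partial_deriv i (U t) x)" for i
      unfolding Ui by (rule continuous_on_comp_wave_frame[OF Tc])
    show "partial_deriv i (U t) differentiable at x" for i t x
      unfolding Ui using wave_frame_space[OF DT] by (auto simp: differentiable_def)
    show "continuous_on UNIV (\<lambda>(t, x). partial_deriv j (partial_deriv i (U t)) x)" for i j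
    proof -
      have "continuous_on UNIV (\<lambda>p. e $ j * DT i p (1, 0) + (1 / L) * DT i p (0, axis j 1))"
        by (intro continuous_intros DTc Basis)
      from continuous_on_comp_wave_frame[OF this] show ?thesis
        unfolding Ui partial_deriv_wave_frame[OF DT] .
    qed
  qed
  have eq: "deriv (\<lambda>s. U s x) t = divergence (\<lambda>z. A (z /\<^sub>R L) *v grad (U t) z) x
        + B (x /\<^sub>R L) \<bullet> grad (U t) x + f (x /\<^sub>R L) (U t x)" for t x
  proof -
    define \<xi> where "\<xi> = x \<bullet> e - c * t + s"
    define y where "y = x /\<^sub>R L"
    have fr: "wave_frame t x = (\<xi>, y)" by (simp add: wave_frame_def \<xi>_def y_def)
    have grad: "grad (U t) z = twisted_grad L e \<phi> (z \<bullet> e - c * t + s) (z /\<^sub>R L)" for z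
      by (simp add: grad_def twisted_grad_def Ui Tw wave_frame_def)
    have "partial_deriv i (\<lambda>z. (A (z /\<^sub>R L) *v grad (U t) z) $ i) x
        = twisted_partial L e i (\<lambda>s z. (A z *v twisted_grad L e \<phi> s z) $ i) \<xi> y" for i
    proof -
      \<comment> \<open>Flux component \<open>i\<close> as a function on the frame, so that its
        twisted derivative and the derivative of its pull-back are read off the same
        \<open>DQ\<close>.\<close>
      define Q where "Q p = (\<Sum>j\<in>UNIV. A (snd p) $ i $ j * T j p)" for p
      have "(\<lambda>p. A (snd p) $ i $ j) differentiable (at p)" for j and p :: "real \<times> (real^'n)"
      proof -
        have "((\<lambda>z. A z $ i $ j) has_derivative (\<lambda>d. grad (\<lambda>z. A z $ i $ j) (snd p) \<bullet> d)) (at (snd p))"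
          by (rule has_derivative_grad[OF differentiable_matrix_entry[OF A]])
        then have "((\<lambda>p. A (snd p) $ i $ j) has_derivative (\<lambda>d. grad (\<lambda>z. A z $ i $ j) (snd p) \<bullet> snd d)) (at p)"
          by (intro has_derivative_compose[of snd snd p UNIV "\<lambda>z. A z $ i $ j"]) (auto intro!: derivative_intros)
        then show ?thesis by (auto simp: differentiable_def)
      qed
      moreover have "T j differentiable (at p)" for j p
        using DT[of j p] unfolding differentiable_def by blast
      ultimately have "Q differentiable (at (\<xi>, y))"
        unfolding Q_def[abs_def] by (intro differentiable_sum differentiable_mult) auto
      then obtain DQ where DQ: "(Q has_derivative DQ) (at (\<xi>, y))" by (auto simp: differentiable_def)
      have Qe: "(A z *v twisted_grad L e \<phi> s' z) $ i = Q (s', z)" for s' z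
        by (simp add: Q_def matrix_vector_mult_def twisted_grad_def Tw)
      have "(\<lambda>z. (A (z /\<^sub>R L) *v grad (U t) z) $ i) = (\<lambda>z. Q (wave_frame t z))"
        by (simp add: grad Qe wave_frame_def)
      then have "partial_deriv i (\<lambda>z. (A (z /\<^sub>R L) *v grad (U t) z) $ i) x
          = e $ i * DQ (1, 0) + (1 / L) * DQ (0, axis i 1)"
        using partial_deriv_wave_frame[of Q DQ t x i] DQ fr by simp
      moreover have "twisted_partial L e i (\<lambda>s z. (A z *v twisted_grad L e \<phi> s z) $ i) \<xi> y
          = e $ i * DQ (1, 0) + (1 / L) * DQ (0, axis i 1)"
        unfolding Qe by (rule twisted_partial_eq) (use DQ in simp)
      ultimately show ?thesis by simp
    qed
    then have "divergence (\<lambda>z. A (z /\<^sub>R L) *v grad (U t) z) x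
        = twisted_div L e (\<lambda>s z. A z *v twisted_grad L e \<phi> s z) \<xi> y"
      by (simp add: divergence_def twisted_div_def)
    moreover have "deriv (\<lambda>s. U s x) t = - c * deriv (\<lambda>s. \<phi> s y) \<xi>"
      using twisted_partial_eq(2)[of \<phi> "D (\<xi>, y)" \<xi> y] D[of "(\<xi>, y)"] by (simp add: Udt fr G_def)
    moreover have "grad (U t) x = twisted_grad L e \<phi> \<xi> y" by (simp add: grad \<xi>_def y_def)
    moreover have "U t x = \<phi> \<xi> y" by (simp add: U_def fr G_def)
    moreover have "twisted_div L e (\<lambda>s z. A z *v twisted_grad L e \<phi> s z) \<xi> y
        + B y \<bullet> twisted_grad L e \<phi> \<xi> y + c * deriv (\<lambda>s. \<phi> s y) \<xi> + f y (\<phi> \<xi> y) = 0"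
      using prof by (simp add: classical_profile_def)
    ultimately show ?thesis by (simp add: y_def)
  qed
  show ?thesis
    unfolding entire_classical_solution_def Ueq[symmetric] using C12 eq by auto
qed

end

section \<open>Estimates on profiles that are uniform in the periodic variable\<close>

text \<open>Needed to lower a translate slightly without using up a gap \<open>m\<close>.
  Compactness of the unit cell makes \<open>d\<close> independent of \<open>y\<close>.\<close>

lemma periodic_equicontinuous:
  fixes \<phi> :: "real \<Rightarrow> real^'n \<Rightarrow> real"
  assumes cont: "continuous_on UNIV (\<lambda>(\<xi>, y). \<phi> \<xi> y)" and per: "\<And>\<xi>. periodic_ZN (\<phi> \<xi>)" and m: "m > 0"
  obtains d where "d > 0"
    "\<And>\<xi> \<xi>' y. \<xi> \<in> {a..b} \<Longrightarrow> \<xi>' \<in> {a..b} \<Longrightarrow> \<bar>\<xi> - \<xi>'\<bar> < d \<Longrightarrow> \<bar>\<phi> \<xi> y - \<phi> \<xi>' y\<bar> < m"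
proof -
  let ?K = "{a..b} \<times> cbox (0::real^'n) 1"
  have "uniformly_continuous_on ?K (\<lambda>(\<xi>, y). \<phi> \<xi> y)"
    by (intro compact_uniformly_continuous compact_Times) (auto intro: continuous_on_subset[OF cont])
  then obtain d where d: "d > 0" "\<And>p q. p \<in> ?K \<Longrightarrow> q \<in> ?K \<Longrightarrow> dist q p < d \<Longrightarrow>
      dist ((\<lambda>(\<xi>, y). \<phi> \<xi> y) q) ((\<lambda>(\<xi>, y). \<phi> \<xi> y) p) < m"
    using m unfolding uniformly_continuous_on_def by metis
  show thesis
  proof (rule that[OF d(1)])
    fix \<xi> \<xi>' and y :: "real^'n"
    assume \<xi>: "\<xi> \<in> {a..b}" "\<xi>' \<in> {a..b}" "\<bar>\<xi> - \<xi>'\<bar> < d"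
    obtain k :: "real^'n" where k: "\<forall>i. k $ i \<in> \<int>" "y - k \<in> cbox 0 1" by (rule periodic_reduce)
    have "\<bar>\<phi> \<xi> (y - k) - \<phi> \<xi>' (y - k)\<bar> < m"
      using d(2)[of "(\<xi>', y - k)" "(\<xi>, y - k)"] \<xi> k(2) by (auto simp: dist_Pair_Pair dist_real_def)
    then show "\<bar>\<phi> \<xi> y - \<phi> \<xi>' y\<bar> < m" by (simp add: periodic_ZN_shift(1)[OF per k(1)])
  qed
qed

lemma wave_limits:
  assumes "pulsating_wave A B f L e \<phi> c" and \<delta>: "\<delta> > 0"
  shows "\<exists>M. (\<forall>\<xi> y. \<xi> \<le> - M \<longrightarrow> \<phi> \<xi> y \<ge> 1 - \<delta>) \<and> (\<forall>\<xi> y. \<xi> \<ge> M \<longrightarrow> \<phi> \<xi> y \<le> \<delta>)"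
proof -
  have "uniform_limit UNIV \<phi> (\<lambda>_. 1) at_bot" "uniform_limit UNIV \<phi> (\<lambda>_. 0) at_top"
    using assms(1) by (simp_all add: pulsating_wave_def)
  from this[THEN uniform_limitD, OF \<delta>] obtain M1 M2 where M: "\<And>\<xi> y. \<xi> \<le> M1 \<Longrightarrow> dist (\<phi> \<xi> y) 1 < \<delta>" "\<And>\<xi> y. \<xi> \<ge> M2 \<Longrightarrow> dist (\<phi> \<xi> y) 0 < \<delta>"
    unfolding eventually_at_bot_linorder eventually_at_top_linorder by blast
  show ?thesis
  proof (intro exI[of _ "max (- M1) M2"] conjI allI impI)
    show "\<phi> \<xi> y \<ge> 1 - \<delta>" if "\<xi> \<le> - max (- M1) M2" for \<xi> y
    proof -
      have "dist (\<phi> \<xi> y) 1 < \<delta>" using that by (intro M) auto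
      then show ?thesis by (auto simp: dist_real_def abs_if split: if_splits)
    qed
    show "\<phi> \<xi> y \<le> \<delta>" if "\<xi> \<ge> max (- M1) M2" for \<xi> y
    proof -
      have "dist (\<phi> \<xi> y) 0 < \<delta>" using that by (intro M) auto
      then show ?thesis by (simp add: dist_real_def)
    qed
  qed
qed

section \<open>Comparison, uniqueness of the speed, sliding\<close>

text \<open>In \<open>stable\<close>, either alternative puts the whole interval from
  \<open>u\<close> to \<open>v\<close> into one of the two zones where \<open>f\<close> decreases:
  \<open>u\<close> is the smaller value and \<open>v\<close> the larger one.\<close>

locale bistable_equation =
  fixes A :: "real^'n \<Rightarrow> real^'n^'n" and B :: "real^'n \<Rightarrow> real^'n"
    and f :: "real^'n \<Rightarrow> real \<Rightarrow> real" and \<eta> \<gamma> \<delta> L C K :: real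
  assumes A_differentiable: "\<And>x. A differentiable (at x)"
    and \<eta>_pos: "\<eta> > 0" and elliptic: "\<And>x d. (A x *v d) \<bullet> d \<ge> \<eta> * (d \<bullet> d)"
    and trace_bound: "\<And>x. A (x /\<^sub>R L) \<bullet> mat 1 \<le> C" and drift_bound: "\<And>x. norm (drift A B L x) \<le> C"
    and \<gamma>_pos: "\<gamma> > 0" and \<delta>: "0 < \<delta>" "\<delta> < 1/2" and L_pos: "L > 0"
    and lipschitz: "\<And>x u v. u \<in> {0..1} \<Longrightarrow> v \<in> {0..1} \<Longrightarrow> \<bar>f x v - f x u\<bar> \<le> K * \<bar>v - u\<bar>"
    and stable: "\<And>x u v. 0 \<le> u \<Longrightarrow> u \<le> v \<Longrightarrow> v \<le> 1 \<Longrightarrow> 1 - \<delta> \<le> u \<or> v \<le> \<delta> \<Longrightarrow> f x v - f x u \<le> - \<gamma> * (v - u)"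
begin

definition solution :: "(real \<Rightarrow> real^'n \<Rightarrow> real) \<Rightarrow> bool" where
  "solution u \<longleftrightarrow> entire_classical_solution A B f L u \<and> (\<forall>t x. 0 < u t x \<and> u t x < 1)"

lemma solution_continuous:
  assumes "solution u"
  shows "continuous_on UNIV (\<lambda>(t, x). u t x)"
  using assms by (simp add: solution_def entire_classical_solution_def C12_def)

lemma solution_bounds:
  assumes "solution u"
  shows "0 < u t x" and "u t x < 1"
  using assms by (simp_all add: solution_def)

lemma wave_solution:
  assumes "pulsating_wave A B f L e \<phi> c"
  shows "solution (\<lambda>t x. \<phi> (x \<bullet> e - c * t) (x /\<^sub>R L))"
  using assms by (simp add: solution_def pulsating_wave_def)

lemma difference_jet:
  assumes "solution u" "solution v"
  obtains \<alpha> p H where "jet (\<lambda>t x. v t x - u t x) t x \<alpha> p H"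
    "\<alpha> = A (x /\<^sub>R L) \<bullet> H + drift A B L x \<bullet> p + (f (x /\<^sub>R L) (v t x) - f (x /\<^sub>R L) (u t x))"
proof -
  obtain \<alpha> p H where 1: "jet v t x \<alpha> p H" "\<alpha> = A (x /\<^sub>R L) \<bullet> H + drift A B L x \<bullet> p + f (x /\<^sub>R L) (v t x)"
    using solution_jet[OF A_differentiable, of B f L v t x] assms(2) by (auto simp: solution_def)
  obtain \<beta> q G where 2: "jet u t x \<beta> q G" "\<beta> = A (x /\<^sub>R L) \<bullet> G + drift A B L x \<bullet> q + f (x /\<^sub>R L) (u t x)"
    using solution_jet[OF A_differentiable, of B f L u t x] assms(1) by (auto simp: solution_def)
  show thesis
    by (rule that[OF jet_diff[OF 1(1) 2(1)]]) (simp add: 1(2) 2(2) inner_diff_right)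
qed

text \<open>The rate \<open>\<kappa>\<close> is left open: the Lipschitz constant yields
  preservation of order, and a negative rate yields decay of the gap.\<close>

lemma comparison:
  assumes u: "solution u" and v: "solution v"
    and reaction: "\<And>t x. t0 < t \<Longrightarrow> t \<le> t1 \<Longrightarrow> v t x > u t x \<Longrightarrow>
      f (x /\<^sub>R L) (v t x) - f (x /\<^sub>R L) (u t x) \<le> \<kappa> * (v t x - u t x)"
    and m: "m \<ge> 0" and init: "\<And>x. v t0 x - u t0 x \<le> m" and t: "t \<in> {t0..t1}"
  shows "v t x - u t x \<le> m * exp (\<kappa> * (t - t0))"
proof (rule max_principle[of "\<lambda>x. A (x /\<^sub>R L)" C "drift A B L" t0 t1 "\<lambda>t x. v t x - u t x" 1])
  show "(A (x /\<^sub>R L) *v d) \<bullet> d \<ge> 0" for x d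
    using elliptic[of d "x /\<^sub>R L"] \<eta>_pos by (meson inner_ge_zero less_imp_le mult_nonneg_nonneg order_trans)
  have "continuous_on UNIV (\<lambda>(t, x). v t x - u t x)"
    using continuous_on_diff[OF solution_continuous[OF v] solution_continuous[OF u]]
    by (simp add: case_prod_unfold)
  then show "continuous_on ({t0..t1} \<times> UNIV) (\<lambda>(t, x). v t x - u t x)"
    by (rule continuous_on_subset) simp
  show "v t x - u t x \<le> 1" for t x
    using solution_bounds[OF u, of t x] solution_bounds[OF v, of t x] by simp
  show "\<exists>\<alpha> p H. jet (\<lambda>t x. v t x - u t x) t x \<alpha> p H \<and>
      \<alpha> \<le> A (x /\<^sub>R L) \<bullet> H + drift A B L x \<bullet> p + \<kappa> * (v t x - u t x)"
    if "t0 < t" "t \<le> t1" "0 < v t x - u t x" for t x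
  proof -
    obtain \<alpha> p H where J: "jet (\<lambda>t x. v t x - u t x) t x \<alpha> p H"
      "\<alpha> = A (x /\<^sub>R L) \<bullet> H + drift A B L x \<bullet> p + (f (x /\<^sub>R L) (v t x) - f (x /\<^sub>R L) (u t x))"
      by (rule difference_jet[OF u v])
    have "v t x > u t x" using that(3) by simp
    from J(1) J(2) reaction[OF that(1,2) this] show ?thesis
      by (intro exI[of _ \<alpha>] exI[of _ p] exI[of _ H]) simp
  qed
qed (use trace_bound drift_bound m init t in auto)

lemma comparison_forward:
  assumes u: "solution u" and v: "solution v" and init: "\<And>x. v t0 x \<le> u t0 x" and t: "t0 \<le> t"
  shows "v t x \<le> u t x"
proof -
  have "v t x - u t x \<le> 0 * exp (K * (t - t0))"
  proof (rule comparison[OF u v, of t0 t])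
    show "f (x /\<^sub>R L) (v t x) - f (x /\<^sub>R L) (u t x) \<le> K * (v t x - u t x)" if "v t x > u t x" for t x
      using lipschitz[of "u t x" "v t x" "x /\<^sub>R L"] u v that by (simp add: solution_def less_imp_le)
  qed (use init t in auto)
  then show ?thesis by simp
qed

text \<open>
  Wherever \<open>v > u\<close> the reaction is dissipative, so the positive part of \<open>v - u\<close>, being bounded since
  \<open>t = -\<infinity>\<close>, has decayed to \<open>0\<close>.
\<close>

lemma comparison_ancient:
  assumes u: "solution u" and v: "solution v"
    and dich: "\<And>t x. t \<le> T \<Longrightarrow> v t x \<le> u t x \<or> 1 - \<delta> \<le> u t x \<or> v t x \<le> \<delta>" and t: "t \<le> T"
  shows "v t x \<le> u t x"
proof -
  \<comment> \<open>Comparison is started at time t - n, where the gap is at most 1 because both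
    solutions take values between 0 and 1.\<close>
  have "v t x - u t x \<le> exp (- \<gamma>) ^ n" for n
  proof -
    have "v t x - u t x \<le> 1 * exp (- \<gamma> * (t - (t - real n)))"
    proof (rule comparison[OF u v, of "t - real n" t])
      show "f (x /\<^sub>R L) (v s x) - f (x /\<^sub>R L) (u s x) \<le> - \<gamma> * (v s x - u s x)"
        if "s \<le> t" "v s x > u s x" for s x
        using stable[of "u s x" "v s x" "x /\<^sub>R L"] dich[of s x] u v that t
        by (auto simp: solution_def less_imp_le)
      show "v (t - real n) x - u (t - real n) x \<le> 1" for x
        using solution_bounds[OF u, of "t - real n" x] solution_bounds[OF v, of "t - real n" x] by simp
    qed auto
    then show ?thesis by (simp add: exp_of_nat_mult[symmetric] mult.commute)
  qed
  moreover have "(\<lambda>n. exp (- \<gamma>) ^ n) \<longlonglongrightarrow> 0"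
    using \<gamma>_pos by (intro LIMSEQ_power_zero) simp
  ultimately have "v t x - u t x \<le> 0"
    by (intro LIMSEQ_le_const[of "\<lambda>n. exp (- \<gamma>) ^ n"]) auto
  then show ?thesis by simp
qed

lemma speed_le:
  assumes w1: "pulsating_wave A B f L e \<phi>1 c1" and w2: "pulsating_wave A B f L e \<phi>2 c2"
    and e: "norm e = 1"
  shows "c2 \<le> c1"
proof (rule ccontr)
  assume "\<not> c2 \<le> c1"
  then have c: "c1 < c2" by simp
  obtain M1 where M1: "\<And>\<xi> y. \<xi> \<le> - M1 \<Longrightarrow> \<phi>1 \<xi> y \<ge> 1 - \<delta>" "\<And>\<xi> y. \<xi> \<ge> M1 \<Longrightarrow> \<phi>1 \<xi> y \<le> \<delta>"
    using wave_limits[OF w1 \<delta>(1)] by blast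
  obtain M2 where M2: "\<And>\<xi> y. \<xi> \<le> - M2 \<Longrightarrow> \<phi>2 \<xi> y \<ge> 1 - \<delta>" "\<And>\<xi> y. \<xi> \<ge> M2 \<Longrightarrow> \<phi>2 \<xi> y \<le> \<delta>"
    using wave_limits[OF w2 \<delta>(1)] by blast
  define u where "u t x = \<phi>1 (x \<bullet> e - c1 * t) (x /\<^sub>R L)" for t x
  define v where "v t x = \<phi>2 (x \<bullet> e - c2 * t) (x /\<^sub>R L)" for t x
  have u: "solution u" using wave_solution[OF w1] by (simp add: u_def[abs_def])
  have v: "solution v" using wave_solution[OF w2] by (simp add: v_def[abs_def])
  \<comment> \<open>Until this time the two frame coordinates differ by at least
    \<open>M1 + M2\<close>, so a point either lies behind the slower front or ahead of the faster
    one.\<close>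
  define T where "T = - (M1 + M2) / (c2 - c1)"
  have le: "v T x \<le> u T x" for x
  proof (rule comparison_ancient[OF u v _ order_refl])
    fix t x assume "t \<le> T"
    then have "(c2 - c1) * t \<le> (c2 - c1) * T" using c by (intro mult_left_mono) auto
    also have "\<dots> = - (M1 + M2)" using c by (simp add: T_def)
    finally have "x \<bullet> e - c1 * t \<le> - M1 \<or> x \<bullet> e - c2 * t \<ge> M2" by (auto simp: algebra_simps)
    then show "v t x \<le> u t x \<or> 1 - \<delta> \<le> u t x \<or> v t x \<le> \<delta>" using M1(1) M2(2) by (auto simp: u_def v_def)
  qed
  \<comment> \<open>Late enough for the midpoint \<open>x\<close> between the positions
    \<open>c1 * s\<close> and \<open>c2 * s\<close> to be far ahead of the slower front and far
    behind the faster one. The absolute values allow for negative \<open>M1\<close> or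
    \<open>M2\<close>.\<close>
  define s where "s = max T ((\<bar>M1\<bar> + \<bar>M2\<bar>) / ((c2 - c1) / 2))"
  define x where "x = ((c1 + c2) / 2 * s) *\<^sub>R e"
  have xe: "x \<bullet> e = (c1 + c2) / 2 * s" using e by (simp add: x_def norm_eq_1)
  have "(\<bar>M1\<bar> + \<bar>M2\<bar>) / ((c2 - c1) / 2) \<le> s" by (simp add: s_def)
  then have "\<bar>M1\<bar> + \<bar>M2\<bar> \<le> s * ((c2 - c1) / 2)" using c by (simp add: pos_divide_le_eq)
  then have "M1 \<le> x \<bullet> e - c1 * s" "x \<bullet> e - c2 * s \<le> - M2"
    unfolding xe by (simp_all add: algebra_simps)
  then have "u s x \<le> \<delta>" "v s x \<ge> 1 - \<delta>" using M1(2) M2(1) by (auto simp: u_def v_def)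
  moreover have "v s x \<le> u s x" by (rule comparison_forward[OF u v le]) (simp add: s_def)
  ultimately show False using \<delta> by simp
qed

text \<open>Contact appears only in the limit of translations by times \<open>\<theta> n\<close> and
  vectors \<open>L *\<^sub>R \<kappa> n\<close>. They preserve \<open>x /\<^sub>R L\<close> modulo
  the lattice and move the first frame variable by an amount tending to \<open>\<sigma>\<close>;
  returning them lets \<open>\<sigma>\<close> be undone later. Times are negative because positivity
  spreads forward, towards a contact placed at time 0.\<close>

lemma sliding:
  assumes wave: "pulsating_wave A B f L e \<phi> c" and wave': "pulsating_wave A B f L e \<phi>' c"
    and shifts: "\<And>s. entire_classical_solution A B f L (\<lambda>t x. \<phi> (x \<bullet> e - c * t + s) (x /\<^sub>R L))"
    and cont: "continuous_on UNIV (\<lambda>(\<xi>, y). \<phi> \<xi> y)" and cont': "continuous_on UNIV (\<lambda>(\<xi>, y). \<phi>' \<xi> y)"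
  shows "\<exists>\<tau> \<sigma> \<kappa> \<theta>.
    (\<forall>t x. t < 0 \<longrightarrow> \<phi>' (x \<bullet> e - c * t + \<sigma>) (x /\<^sub>R L) = \<phi> (x \<bullet> e - c * t + \<sigma> - \<tau>) (x /\<^sub>R L)) \<and>
    (\<forall>n i. \<kappa> n $ i \<in> \<int>) \<and> (\<lambda>n. L * (\<kappa> n \<bullet> e) - c * \<theta> n) \<longlonglongrightarrow> \<sigma>"
proof -
  have range: "0 < \<phi> \<xi> y" "\<phi> \<xi> y < 1" "0 < \<phi>' \<xi> y" "\<phi>' \<xi> y < 1" for \<xi> y
    using wave wave' by (auto simp: pulsating_wave_def)
  have per: "periodic_ZN (\<phi> \<xi>)" "periodic_ZN (\<phi>' \<xi>)" for \<xi>
    using wave wave' by (auto simp: pulsating_wave_def)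
  define U where "U \<tau> t x = \<phi> (x \<bullet> e - c * t - \<tau>) (x /\<^sub>R L)" for \<tau> t x
  define v where "v t x = \<phi>' (x \<bullet> e - c * t) (x /\<^sub>R L)" for t x
  have U: "solution (U \<tau>)" for \<tau>
    using shifts[of "- \<tau>"] range by (simp add: solution_def U_def[abs_def])
  have v: "solution v" using wave_solution[OF wave'] by (simp add: v_def[abs_def])
  obtain M where M: "\<And>\<xi> y. \<xi> \<le> - M \<Longrightarrow> \<phi> \<xi> y \<ge> 1 - \<delta>" "\<And>\<xi> y. \<xi> \<ge> M \<Longrightarrow> \<phi> \<xi> y \<le> \<delta>"
    using wave_limits[OF wave \<delta>(1)] by blast
  obtain M' where M': "\<And>\<xi> y. \<xi> \<le> - M' \<Longrightarrow> \<phi>' \<xi> y \<ge> 1 - \<delta>" "\<And>\<xi> y. \<xi> \<ge> M' \<Longrightarrow> \<phi>' \<xi> y \<le> \<delta>"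
    using wave_limits[OF wave' \<delta>(1)] by blast
  define S where "S = {\<tau>. \<forall>t x. v t x \<le> U \<tau> t x}"
  \<comment> \<open>By this much shift, every point where \<open>\<phi>'\<close> may exceed
    \<open>\<delta>\<close> lies where the translate of \<open>\<phi>\<close> is at least
    \<open>1 - \<delta>\<close>.\<close>
  have "M + M' \<in> S"
    unfolding S_def
  proof (intro CollectI allI)
    fix t x
    show "v t x \<le> U (M + M') t x"
    proof (rule comparison_ancient[OF U v _ order_refl])
      fix s z
      have "z \<bullet> e - c * s - (M + M') \<le> - M \<or> z \<bullet> e - c * s \<ge> M'" by linarith
      then show "v s z \<le> U (M + M') s z \<or> 1 - \<delta> \<le> U (M + M') s z \<or> v s z \<le> \<delta>"
        using M(1) M'(2) by (auto simp: U_def v_def)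
    qed
  qed
  then have S_ne: "S \<noteq> {}" by auto
  \<comment> \<open>Looking at \<open>t = 0\<close>, \<open>x = 0\<close> suffices:
    \<open>\<phi> (- \<tau>) 0\<close> tends to 0 as \<open>\<tau>\<close> tends to minus infinity,
    while \<open>\<phi>' 0 0\<close> is positive.\<close>
  have S_bdd: "bdd_below S"
  proof -
    have "\<phi>' 0 0 / 2 > 0" using range(3)[of 0 0] by simp
    then obtain N where N: "\<And>\<xi> y. \<xi> \<le> - N \<Longrightarrow> \<phi> \<xi> y \<ge> 1 - \<phi>' 0 0 / 2"
        "\<And>\<xi> y. \<xi> \<ge> N \<Longrightarrow> \<phi> \<xi> y \<le> \<phi>' 0 0 / 2"
      using wave_limits[OF wave] by blast
    have "- N \<le> \<tau>" if "\<tau> \<in> S" for \<tau>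
    proof (rule ccontr)
      assume "\<not> - N \<le> \<tau>"
      then have "\<phi> (- \<tau>) 0 \<le> \<phi>' 0 0 / 2" by (intro N(2)) simp
      moreover have "\<phi>' 0 0 \<le> \<phi> (- \<tau>) 0"
        using that[unfolded S_def, simplified, rule_format, of 0 0] by (simp add: U_def v_def)
      ultimately show False using range(3)[of 0 0] by simp
    qed
    then show ?thesis by (auto simp: bdd_below_def)
  qed
  have S_closed: "closed S"
  proof -
    have "closed {\<tau>. v t x \<le> U \<tau> t x}" for t x
    proof -
      have "continuous_on UNIV (\<lambda>\<tau>. (\<lambda>(\<xi>, y). \<phi> \<xi> y) (x \<bullet> e - c * t - \<tau>, x /\<^sub>R L))"
        by (rule continuous_on_compose2[OF cont]) (auto intro!: continuous_intros)
      then show ?thesis unfolding U_def by (intro closed_Collect_le continuous_intros) simp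
    qed
    then have "closed (\<Inter>t. \<Inter>x. {\<tau>. v t x \<le> U \<tau> t x})" by blast
    also have "(\<Inter>t. \<Inter>x. {\<tau>. v t x \<le> U \<tau> t x}) = S" by (auto simp: S_def)
    finally show ?thesis .
  qed
  define \<tau> where "\<tau> = Inf S"
  have \<tau>S: "\<tau> \<in> S" unfolding \<tau>_def by (rule closed_contains_Inf[OF S_ne S_bdd S_closed])
  define W where "W \<xi> y = \<phi> (\<xi> - \<tau>) y - \<phi>' \<xi> y" for \<xi> y
  define w where "w t x = U \<tau> t x - v t x" for t x
  have wW: "w t x = W (x \<bullet> e - c * t) (x /\<^sub>R L)" for t x by (simp add: w_def W_def U_def v_def)
  have w_nonneg: "w t x \<ge> 0" for t x using \<tau>S by (simp add: S_def w_def)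
  have W_per: "periodic_ZN (W \<xi>)" for \<xi> using per by (simp add: periodic_ZN_def W_def)
  have W_cont: "continuous_on UNIV (\<lambda>(\<xi>, y). W \<xi> y)"
  proof -
    have "continuous_on UNIV (\<lambda>p. (\<lambda>(\<xi>, y). \<phi> \<xi> y) (fst p - \<tau>, snd p))"
      by (rule continuous_on_compose2[OF cont]) (auto intro!: continuous_intros)
    from continuous_on_diff[OF this cont'] show ?thesis by (simp add: W_def case_prod_unfold)
  qed
  have W_tendsto: "(\<lambda>n. W (a n) (b n)) \<longlonglongrightarrow> W a' b'" if "a \<longlonglongrightarrow> a'" "b \<longlonglongrightarrow> b'" for a b a' b'
    using continuous_on_tendsto_compose[OF W_cont tendsto_Pair[OF that]] by simp
  \<comment> \<open>Beyond \<open>R\<close> on the right \<open>\<phi>'\<close> is at most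
    \<open>\<delta>\<close>; beyond it on the left the translate is at least
    \<open>1 - \<delta>\<close>. The \<open>+ 1\<close> keeps the latter true after lowering
    \<open>\<tau>\<close> by up to 1.\<close>
  define R where "R = max M' (M - \<tau> + 1)"
  have touch: "\<exists>t x. \<bar>x \<bullet> e - c * t\<bar> \<le> R \<and> w t x < m" if m: "m > 0" for m
  proof (rule ccontr)
    assume "\<not> ?thesis"
    then have big: "w t x \<ge> m" if "\<bar>x \<bullet> e - c * t\<bar> \<le> R" for t x using that not_less by blast
    obtain d where d: "d > 0" "\<And>\<xi> \<xi>' y. \<xi> \<in> {- R - \<tau>..R - \<tau> + 1} \<Longrightarrow> \<xi>' \<in> {- R - \<tau>..R - \<tau> + 1} \<Longrightarrow>
        \<bar>\<xi> - \<xi>'\<bar> < d \<Longrightarrow> \<bar>\<phi> \<xi> y - \<phi> \<xi>' y\<bar> < m"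
      by (rule periodic_equicontinuous[OF cont per(1) m]) blast
    \<comment> \<open>At most 1 to stay within the margin of \<open>R\<close>, and below
      \<open>d\<close> so that \<open>\<phi>\<close> changes by less than \<open>m\<close>.
      Comparison then extends the order from the slab to all points, against the minimality of
      \<open>\<tau>\<close>.\<close>
    define \<eta>' where "\<eta>' = min 1 (d / 2)"
    have \<eta>': "0 < \<eta>'" "\<eta>' \<le> 1" "\<eta>' < d" using d(1) by (auto simp: \<eta>'_def)
    have "v t x \<le> U (\<tau> - \<eta>') t x" for t x
    proof (rule comparison_ancient[OF U v _ order_refl])
      fix s z
      define \<xi> where "\<xi> = z \<bullet> e - c * s"
      consider "\<bar>\<xi>\<bar> \<le> R" | "\<xi> < - R" | "\<xi> > R" by linarith
      then show "v s z \<le> U (\<tau> - \<eta>') s z \<or> 1 - \<delta> \<le> U (\<tau> - \<eta>') s z \<or> v s z \<le> \<delta>"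
      proof cases
        case 1
        then have "\<bar>\<phi> (\<xi> - \<tau> + \<eta>') (z /\<^sub>R L) - \<phi> (\<xi> - \<tau>) (z /\<^sub>R L)\<bar> < m"
          using \<eta>' by (intro d(2)) auto
        moreover have "w s z \<ge> m" using 1 by (intro big) (simp add: \<xi>_def)
        ultimately have "v s z \<le> U (\<tau> - \<eta>') s z"
          by (simp add: w_def U_def \<xi>_def diff_diff_eq2 add_diff_eq diff_add_eq)
        then show ?thesis by simp
      next
        case 2
        then have "1 - \<delta> \<le> \<phi> (\<xi> - (\<tau> - \<eta>')) (z /\<^sub>R L)" using \<eta>' by (intro M(1)) (simp add: R_def)
        then show ?thesis by (simp add: U_def \<xi>_def)
      next
        case 3
        then have "v s z \<le> \<delta>" unfolding v_def by (intro M'(2)) (simp add: R_def \<xi>_def)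
        then show ?thesis by simp
      qed
    qed
    then have "\<tau> - \<eta>' \<in> S" by (simp add: S_def)
    then have "\<tau> \<le> \<tau> - \<eta>'" unfolding \<tau>_def by (intro cInf_lower S_bdd)
    then show False using \<eta>' by simp
  qed
  have "\<exists>t x k. \<bar>x \<bullet> e - c * t\<bar> \<le> R \<and> w t x < 1 / (real n + 1) \<and> (\<forall>i. k $ i \<in> \<int>) \<and> x /\<^sub>R L - k \<in> cbox 0 1" for n
    using touch[of "1 / (real n + 1)"] periodic_reduce by (metis add.commute of_nat_Suc of_nat_0_less_iff zero_less_Suc zero_less_divide_1_iff)
  then obtain tn xn kn where seq: "\<And>n. \<bar>xn n \<bullet> e - c * tn n\<bar> \<le> R" "\<And>n. w (tn n) (xn n) < 1 / (real n + 1)"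
      "\<And>n i. kn n $ i \<in> \<int>" "\<And>n. xn n /\<^sub>R L - kn n \<in> cbox 0 1"
    by metis
  define \<xi>n where "\<xi>n n = xn n \<bullet> e - c * tn n" for n
  define zn where "zn n = xn n /\<^sub>R L - kn n" for n
  have inK: "(\<xi>n n, zn n) \<in> {- R..R} \<times> cbox 0 1" for n
    using seq(1)[of n] seq(4)[of n] by (auto simp: \<xi>n_def zn_def)
  have "compact ({- R..R} \<times> cbox (0::real^'n) 1)" by (intro compact_Times) auto
  then have "seq_compact ({- R..R} \<times> cbox (0::real^'n) 1)" by (rule compact_imp_seq_compact)
  then obtain q r where r: "strict_mono r" and lim: "((\<lambda>n. (\<xi>n n, zn n)) \<circ> r) \<longlonglongrightarrow> q"
    by (rule seq_compactE[OF _ allI, OF _ inK])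
  define \<xi>s where "\<xi>s = fst q"
  define zs where "zs = snd q"
  have \<xi>lim: "(\<lambda>n. \<xi>n (r n)) \<longlonglongrightarrow> \<xi>s" and zlim: "(\<lambda>n. zn (r n)) \<longlonglongrightarrow> zs"
    using tendsto_fst[OF lim] tendsto_snd[OF lim] by (simp_all add: o_def \<xi>s_def zs_def)
  have W0: "W \<xi>s zs \<le> 0"
  proof -
    have "W (\<xi>n (r n)) (zn (r n)) \<le> 1 / (real n + 1)" for n
    proof -
      have "W (\<xi>n (r n)) (zn (r n)) = w (tn (r n)) (xn (r n))"
        using periodic_ZN_shift(1)[OF W_per, of "kn (r n)"] seq(3) by (simp add: wW \<xi>n_def zn_def)
      also have "\<dots> \<le> 1 / (real (r n) + 1)" using seq(2)[of "r n"] by simp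
      also have "\<dots> \<le> 1 / (real n + 1)" using seq_suble[OF r, of n] by (simp add: frac_le)
      finally show ?thesis .
    qed
    moreover have "(\<lambda>n. 1 / (real n + 1)) \<longlonglongrightarrow> 0" using LIMSEQ_inverse_real_of_nat by (simp add: inverse_eq_divide add.commute)
    ultimately show ?thesis using LIMSEQ_le[OF W_tendsto[OF \<xi>lim zlim]] by blast
  qed
  \<comment> \<open>Shift of the first frame variable under the translation by
    \<open>tn (r n)\<close> in time and \<open>L *\<^sub>R kn (r n)\<close> in space.\<close>
  define \<sigma>n where "\<sigma>n n = L * (kn (r n) \<bullet> e) - c * tn (r n)" for n
  \<comment> \<open>Chosen so that, with offset \<open>\<sigma>\<close>, the contact point
    \<open>(\<xi>s, zs)\<close> is the frame point of \<open>L *\<^sub>R zs\<close> at time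
    0.\<close>
  define \<sigma> where "\<sigma> = \<xi>s - L * (zs \<bullet> e)"
  have \<sigma>n: "\<sigma>n n = \<xi>n (r n) - L * (zn (r n) \<bullet> e)" for n
  proof -
    have "L * (zn m \<bullet> e) = xn m \<bullet> e - L * (kn m \<bullet> e)" for m
      using L_pos by (simp add: zn_def inner_diff_left right_diff_distrib)
    then show ?thesis by (simp add: \<sigma>n_def \<xi>n_def)
  qed
  have \<sigma>lim: "\<sigma>n \<longlonglongrightarrow> \<sigma>"
    unfolding \<sigma>n \<sigma>_def by (intro tendsto_intros \<xi>lim zlim)
  have translate: "w (t + tn (r n)) (x + L *\<^sub>R kn (r n)) = W (x \<bullet> e - c * t + \<sigma>n n) (x /\<^sub>R L)" for t x n
  proof -
    have "(x + L *\<^sub>R kn (r n)) /\<^sub>R L = x /\<^sub>R L + kn (r n)"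
      using L_pos by (simp add: scaleR_add_right)
    moreover have "(x + L *\<^sub>R kn (r n)) \<bullet> e - c * (t + tn (r n)) = x \<bullet> e - c * t + \<sigma>n n"
      by (simp add: \<sigma>n_def inner_add_left algebra_simps)
    ultimately show ?thesis
      using periodic_ZN_shift(2)[OF W_per, of "kn (r n)"] seq(3) by (simp add: wW)
  qed
  have w_cont: "continuous_on UNIV (\<lambda>(t, x). w t x)"
    using continuous_on_diff[OF solution_continuous[OF U] solution_continuous[OF v]]
    by (simp add: w_def case_prod_unfold)
  have vanish: "W (x \<bullet> e - c * t + \<sigma>) (x /\<^sub>R L) = 0" if t: "t < 0" for t x
  proof (rule ccontr)
    assume nz: "W (x \<bullet> e - c * t + \<sigma>) (x /\<^sub>R L) \<noteq> 0"
    have conv: "(\<lambda>n. w (t + tn (r n)) (x + L *\<^sub>R kn (r n))) \<longlonglongrightarrow> W (x \<bullet> e - c * t + \<sigma>) (x /\<^sub>R L)"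
      unfolding translate by (intro W_tendsto tendsto_intros \<sigma>lim)
    define \<epsilon> where "\<epsilon> = W (x \<bullet> e - c * t + \<sigma>) (x /\<^sub>R L) / 2"
    have \<epsilon>: "\<epsilon> > 0"
      using LIMSEQ_le_const[OF conv, of 0] w_nonneg nz by (auto simp: \<epsilon>_def)
    have "continuous_on UNIV (\<lambda>p. (\<lambda>(\<xi>, y). W \<xi> y) (snd p \<bullet> e - c * t + fst p, snd p /\<^sub>R L))"
      by (rule continuous_on_compose2[OF W_cont]) (auto intro!: continuous_intros)
    then have "isCont (\<lambda>p. W (snd p \<bullet> e - c * t + fst p) (snd p /\<^sub>R L)) (\<sigma>, x)"
      by (simp add: continuous_on_eq_continuous_at)
    \<comment> \<open>The neighbourhood is joint in offset and position: half of \<open>d\<close>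
      will be spent on the error of \<open>\<sigma>n\<close>, the other half on a ball around
      \<open>x\<close>.\<close>
    then obtain d where d: "d > 0" "\<And>p. dist p (\<sigma>, x) < d \<Longrightarrow>
        dist (W (snd p \<bullet> e - c * t + fst p) (snd p /\<^sub>R L)) (W (x \<bullet> e - c * t + \<sigma>) (x /\<^sub>R L)) < \<epsilon>"
      using \<epsilon> unfolding continuous_at_eps_delta by fastforce
    \<comment> \<open>Duration \<open>- t\<close> and displacement \<open>L *\<^sub>R zs - x\<close>
      are the same for all translates, so the lower bound \<open>k * \<epsilon>\<close> at the
      contact point does not depend on \<open>n\<close> and survives in the limit.\<close>
    obtain k where k: "k > 0" "\<And>w \<epsilon> t0 x0. continuous_on ({t0..t0 + (- t)} \<times> UNIV) (\<lambda>(t, x). w t x) \<Longrightarrow>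
        (\<And>s x. s \<in> {t0..t0 + (- t)} \<Longrightarrow> w s x \<ge> 0) \<Longrightarrow>
        (\<And>s x. t0 < s \<Longrightarrow> s \<le> t0 + (- t) \<Longrightarrow>
           \<exists>\<alpha> p H. jet w s x \<alpha> p H \<and> \<alpha> \<ge> A (x /\<^sub>R L) \<bullet> H + drift A B L x \<bullet> p - K * w s x) \<Longrightarrow>
        \<epsilon> > 0 \<Longrightarrow> (\<And>x. dist x x0 \<le> d / 2 \<Longrightarrow> w t0 x \<ge> \<epsilon>) \<Longrightarrow> k * \<epsilon> \<le> w (t0 + (- t)) (x0 + (L *\<^sub>R zs - x))"
      by (rule strong_positivity[of \<eta> "\<lambda>x. A (x /\<^sub>R L)" C "drift A B L" "- t" "d / 2" K "L *\<^sub>R zs - x"])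
        (use \<eta>_pos elliptic trace_bound drift_bound t d(1) in auto)
    have lower: "\<forall>\<^sub>F n in sequentially. k * \<epsilon> \<le> w (0 + tn (r n)) (L *\<^sub>R zs + L *\<^sub>R kn (r n))"
    proof -
      have "\<forall>\<^sub>F n in sequentially. dist (\<sigma>n n) \<sigma> < d / 2" using \<sigma>lim d(1) by (intro tendstoD) auto
      then show ?thesis
      proof eventually_elim
        case (elim n)
        define t0 where "t0 = t + tn (r n)"
        define x0 where "x0 = x + L *\<^sub>R kn (r n)"
        have "k * \<epsilon> \<le> w (t0 + (- t)) (x0 + (L *\<^sub>R zs - x))"
        proof (rule k(2)[OF _ w_nonneg _ \<epsilon>])
          show "continuous_on ({t0..t0 + (- t)} \<times> UNIV) (\<lambda>(t, x). w t x)"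
            by (rule continuous_on_subset[OF w_cont]) simp
          show "\<exists>\<alpha> p H. jet w s x \<alpha> p H \<and> \<alpha> \<ge> A (x /\<^sub>R L) \<bullet> H + drift A B L x \<bullet> p - K * w s x" for s x
          proof -
            obtain \<alpha> p H where J: "jet (\<lambda>t x. U \<tau> t x - v t x) s x \<alpha> p H"
              "\<alpha> = A (x /\<^sub>R L) \<bullet> H + drift A B L x \<bullet> p + (f (x /\<^sub>R L) (U \<tau> s x) - f (x /\<^sub>R L) (v s x))"
              by (rule difference_jet[OF v U])
            have "f (x /\<^sub>R L) (U \<tau> s x) - f (x /\<^sub>R L) (v s x) \<ge> - (K * w s x)"
              using lipschitz[of "v s x" "U \<tau> s x" "x /\<^sub>R L"] U[of \<tau>] v w_nonneg[of s x]
              by (simp add: solution_def less_imp_le w_def abs_le_iff)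
            then show ?thesis using J by (intro exI[of _ \<alpha>] exI[of _ p] exI[of _ H]) (simp add: w_def[abs_def])
          qed
          show "\<epsilon> \<le> w t0 x'" if "dist x' x0 \<le> d / 2" for x'
          proof -
            define y where "y = x' - L *\<^sub>R kn (r n)"
            have "dist y x \<le> d / 2" using that by (simp add: y_def x0_def dist_norm algebra_simps)
            then have "dist (\<sigma>n n, y) (\<sigma>, x) < d"
              using sqrt_sum_squares_le_sum_abs[of "dist (\<sigma>n n) \<sigma>" "dist y x"] elim by (simp add: dist_Pair_Pair)
            from d(2)[OF this] have "W (y \<bullet> e - c * t + \<sigma>n n) (y /\<^sub>R L) \<ge> \<epsilon>"
              unfolding dist_real_def \<epsilon>_def fst_conv snd_conv by linarith
            then show ?thesis using translate[of t n y] by (simp add: t0_def y_def)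
          qed
        qed
        then show ?case by (simp add: t0_def x0_def algebra_simps)
      qed
    qed
    have "(\<lambda>n. w (0 + tn (r n)) (L *\<^sub>R zs + L *\<^sub>R kn (r n))) \<longlonglongrightarrow> W ((L *\<^sub>R zs) \<bullet> e - c * 0 + \<sigma>) ((L *\<^sub>R zs) /\<^sub>R L)"
      unfolding translate by (intro W_tendsto tendsto_intros \<sigma>lim)
    also have "W ((L *\<^sub>R zs) \<bullet> e - c * 0 + \<sigma>) ((L *\<^sub>R zs) /\<^sub>R L) = W \<xi>s zs"
      using L_pos by (simp add: \<sigma>_def)
    finally have "k * \<epsilon> \<le> W \<xi>s zs"
      by (rule tendsto_lowerbound[OF _ lower]) simp
    with W0 mult_pos_pos[OF k(1) \<epsilon>] show False by simp
  qed
  show ?thesis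
  proof (rule exI[of _ \<tau>], rule exI[of _ \<sigma>], rule exI[of _ "\<lambda>n. kn (r n)"],
      rule exI[of _ "\<lambda>n. tn (r n)"], intro conjI allI impI)
    show "\<phi>' (x \<bullet> e - c * t + \<sigma>) (x /\<^sub>R L) = \<phi> (x \<bullet> e - c * t + \<sigma> - \<tau>) (x /\<^sub>R L)" if "t < 0" for t x
      using vanish[OF that, of x] by (simp add: W_def)
    show "(\<lambda>n. L * (kn (r n) \<bullet> e) - c * tn (r n)) \<longlonglongrightarrow> \<sigma>"
      using \<sigma>lim by (simp add: \<sigma>n_def[abs_def])
  qed (rule seq(3))
qed

end

section \<open>From the hypotheses on the reaction to the theorem\<close>

text \<open>\<open>K\<close> bounds the derivative in \<open>u\<close>, one-sided at 0 and 1, on the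
  compact product of the unit cell with \<open>{0..1}\<close>; periodicity moves \<open>x\<close>
  into the cell.\<close>

lemma reaction_lipschitz:
  fixes f :: "real^'n \<Rightarrow> real \<Rightarrow> real"
  assumes f: "Ck_on (Suc k) (UNIV \<times> {0..1}) (\<lambda>(x, u). f x u)"
    and per: "\<And>u. u \<in> {0..1} \<Longrightarrow> periodic_ZN (\<lambda>x. f x u)"
  shows "\<exists>K. \<forall>x. \<forall>u\<in>{0..1}. \<forall>v\<in>{0..1}. \<bar>f x v - f x u\<bar> \<le> K * \<bar>v - u\<bar>"
proof -
  obtain D where D: "\<And>p. p \<in> UNIV \<times> {0..1} \<Longrightarrow>
        ((\<lambda>(x, u). f x u) has_derivative D p) (at p within UNIV \<times> {0..1})"
      and Dc: "\<And>b. b \<in> Basis \<Longrightarrow> Ck_on k (UNIV \<times> {0..1}) (\<lambda>p. D p b)"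
    using f unfolding Ck_on.simps by blast
  have "(0, 1) \<in> (Basis :: ((real^'n) \<times> real) set)" by (auto simp: Basis_prod_def)
  then have "continuous_on (UNIV \<times> {0..1}) (\<lambda>p. D p (0, 1))"
    by (intro Ck_on_imp_continuous_on[of k] Dc)
  then have "continuous_on (cbox 0 1 \<times> {0..1}) (\<lambda>p. D p (0, 1))"
    by (rule continuous_on_subset) auto
  then have "compact ((\<lambda>p. D p (0, 1)) ` (cbox 0 1 \<times> {0..1}))"
    by (intro compact_continuous_image compact_Times) auto
  then have "bounded ((\<lambda>p. D p (0, 1)) ` (cbox 0 1 \<times> {0..1}))" by (rule compact_imp_bounded)
  then obtain K where K: "\<And>p. p \<in> cbox 0 1 \<times> {0..1} \<Longrightarrow> norm (D p (0, 1)) \<le> K"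
    unfolding bounded_iff by blast
  show ?thesis
  proof (intro exI[of _ K] allI ballI)
    fix x :: "real^'n" and u v :: real assume uv: "u \<in> {0..1}" "v \<in> {0..1}"
    obtain j :: "real^'n" where j: "\<forall>i. j $ i \<in> \<int>" "x - j \<in> cbox 0 1" by (rule periodic_reduce)
    have red: "f x s = f (x - j) s" if "s \<in> {0..1}" for s
      using periodic_ZN_shift(1)[OF per[OF that] j(1), of x] by simp
    have "(f (x - j) has_real_derivative D (x - j, s) (0, 1)) (at s within {0..1})" if s: "s \<in> {0..1}" for s
    proof -
      have Ds: "((\<lambda>(x, u). f x u) has_derivative D (x - j, s)) (at (x - j, s) within UNIV \<times> {0..1})"
        using s by (intro D) auto
      have "((\<lambda>s. (\<lambda>(x, u). f x u) (x - j, s)) has_derivative (\<lambda>r. D (x - j, s) (0, r))) (at s within {0..1})"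
        by (rule has_derivative_in_compose[of "\<lambda>s. (x - j, s)" _ s "{0..1}" "\<lambda>(x, u). f x u"])
          (auto intro!: derivative_eq_intros has_derivative_subset[OF Ds])
      moreover have "(\<lambda>r. D (x - j, s) (0, r)) = (*) (D (x - j, s) (0, 1))"
      proof
        fix r show "D (x - j, s) (0, r) = D (x - j, s) (0, 1) * r"
          using linear_cmul[OF has_derivative_linear[OF Ds], of r "(0, 1)"] by simp
      qed
      ultimately show ?thesis by (simp add: has_field_derivative_def)
    qed
    from field_differentiable_bound[OF _ this, of K v u] K j(2) uv
    have "\<bar>f (x - j) v - f (x - j) u\<bar> \<le> K * \<bar>v - u\<bar>" by auto
    then show "\<bar>f x v - f x u\<bar> \<le> K * \<bar>v - u\<bar>" using red uv by simp
  qed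
qed

text \<open>The mean value theorem on \<open>{u..v}\<close>. The larger set \<open>S\<close>
  accommodates derivatives that are one-sided at the ends of \<open>{0..1}\<close>.\<close>

lemma decrease_of_derivative_bound:
  fixes h :: "real \<Rightarrow> real"
  assumes "u \<le> v" and "{u..v} \<subseteq> S"
    and "\<And>s. s \<in> {u..v} \<Longrightarrow> \<exists>d. (h has_real_derivative d) (at s within S) \<and> d \<le> - \<gamma>"
  shows "h v - h u \<le> - \<gamma> * (v - u)"
proof -
  obtain d where d: "\<And>s. s \<in> {u..v} \<Longrightarrow> (h has_real_derivative d s) (at s within S) \<and> d s \<le> - \<gamma>"
    using assms(3) by metis
  have "(h has_derivative (*) (d s)) (at s within {u..v})" if "u \<le> s" "s \<le> v" for s
    using d[of s] that assms(2) by (auto simp: has_field_derivative_def intro: has_derivative_subset)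
  from mvt_very_simple[OF assms(1) this] obtain s where "s \<in> {u..v}" "h v - h u = d s * (v - u)" by blast
  then show ?thesis using d[of s] assms(1) by (metis diff_ge_0_iff_ge mult_right_mono)
qed

theorem theorem1p2:
  fixes A :: "real^'n \<Rightarrow> real^'n^'n"
    and B :: "real^'n \<Rightarrow> real^'n"
    and f :: "real^'n \<Rightarrow> real \<Rightarrow> real"
    and \<eta>0 \<gamma>0 \<delta>0 L c c' :: real
    and e :: "real^'n"
    and \<phi> \<phi>' :: "real \<Rightarrow> real^'n \<Rightarrow> real"
  assumes A_periodic: "periodic_ZN A"
    and A_C2: "Ck_on 2 UNIV A"
    and \<eta>0: "\<eta>0 > 0"
    and A_elliptic: "\<And>x \<xi>. (\<Sum>i\<in>UNIV. \<Sum>j\<in>UNIV. A x $ i $ j * \<xi> $ i * \<xi> $ j) \<ge> \<eta>0 * (norm \<xi>)\<^sup>2"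
    and B_periodic: "periodic_ZN B"
    and B_C1: "Ck_on 1 UNIV B"
    and f_C3: "Ck_on 3 (UNIV \<times> {0..1}) (\<lambda>(x, u). f x u)"
    and f_periodic: "\<And>u. u \<in> {0..1} \<Longrightarrow> periodic_ZN (\<lambda>x. f x u)"
    and f_zero: "\<And>x. f x 0 = 0 \<and> f x 1 = 0"
    and \<gamma>0: "\<gamma>0 > 0"
    and \<delta>0: "0 < \<delta>0" "\<delta>0 < 1/2"
    and f_u: "\<And>x u. u \<in> {0..\<delta>0} \<union> {1 - \<delta>0..1} \<Longrightarrow>
                \<exists>d. (f x has_real_derivative d) (at u within {0..1}) \<and> d \<le> - \<gamma>0"
    and L: "L > 0"
    and e: "norm e = 1"
    and wave: "pulsating_wave A B f L e \<phi> c"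
    and profile: "classical_profile A B f L e \<phi> c"
    and wave': "pulsating_wave A B f L e \<phi>' c'"
  shows "c' = c \<and>
    (c \<noteq> 0 \<longrightarrow> (\<exists>\<tau>0. \<forall>\<xi> y. \<phi>' \<xi> y = \<phi> (\<xi> + \<tau>0) y)) \<and>
    (c = 0 \<and> continuous_on UNIV (\<lambda>(\<xi>, y). \<phi>' \<xi> y) \<longrightarrow>
       (\<exists>\<tau>0. \<forall>x. \<phi>' (x \<bullet> e) (x /\<^sub>R L) = \<phi> (x \<bullet> e + \<tau>0) (x /\<^sub>R L)))"
proof -
  obtain C where C: "\<And>x. A (x /\<^sub>R L) \<bullet> mat 1 \<le> C" "\<And>x. norm (drift A B L x) \<le> C"
    using coefficient_bounds[OF A_periodic A_C2 B_periodic B_C1] by metis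
  have A_diff: "\<And>x. A differentiable (at x)"
    using Ck_on_imp_differentiable[of "Suc 0" A] A_C2 by (simp only: numeral_2_eq_2)
  have "Ck_on (Suc 2) (UNIV \<times> {0..1}) (\<lambda>(x, u). f x u)" using f_C3 by (simp only: eval_nat_numeral)
  then have "\<exists>K. \<forall>x. \<forall>u\<in>{0..1}. \<forall>v\<in>{0..1}. \<bar>f x v - f x u\<bar> \<le> K * \<bar>v - u\<bar>"
    by (rule reaction_lipschitz[OF _ f_periodic])
  then obtain K where K: "\<And>x u v. u \<in> {0..1} \<Longrightarrow> v \<in> {0..1} \<Longrightarrow> \<bar>f x v - f x u\<bar> \<le> K * \<bar>v - u\<bar>"
    by blast
  interpret bistable_equation A B f \<eta>0 \<gamma>0 \<delta>0 L C K
  proof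
    show "(A x *v d) \<bullet> d \<ge> \<eta>0 * (d \<bullet> d)" for x d
      using A_elliptic[of d x] by (simp add: inner_matrix_vec power2_norm_eq_inner)
    show "f x v - f x u \<le> - \<gamma>0 * (v - u)"
      if "0 \<le> u" "u \<le> v" "v \<le> 1" "1 - \<delta>0 \<le> u \<or> v \<le> \<delta>0" for x u v
      by (rule decrease_of_derivative_bound[where S = "{0..1}"]) (use that in \<open>auto intro!: f_u\<close>)
  qed (use A_diff \<eta>0 C \<gamma>0 \<delta>0 L K in auto)
  have c': "c' = c"
    using speed_le[OF wave wave' e] speed_le[OF wave' wave e] by simp
  note wave' = wave'[unfolded c']
  have per: "periodic_ZN (\<phi> \<xi>)" "periodic_ZN (\<phi>' \<xi>)" for \<xi>
    using wave wave' by (auto simp: pulsating_wave_def)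
  have cont: "continuous_on UNIV (\<lambda>(\<xi>, y). \<phi> \<xi> y)"
    using profile Ck_on_imp_continuous_on by (auto simp: classical_profile_def)
  note slide = sliding[OF wave wave' profile_shift_solution[OF profile A_diff] cont]
  have "\<exists>\<tau>0. \<forall>\<xi> y. \<phi>' \<xi> y = \<phi> (\<xi> + \<tau>0) y" if c: "c \<noteq> 0"
  proof -
    define u where "u t x = \<phi>' (x \<bullet> e - c * t) (x /\<^sub>R L)" for t x
    have uc: "continuous_on UNIV (\<lambda>(t, x). u t x)"
      unfolding u_def by (rule solution_continuous[OF wave_solution[OF wave']])
    \<comment> \<open>For \<open>c \<noteq> 0\<close> each \<open>(\<xi>, y)\<close> is the frame
      point of \<open>L *\<^sub>R y\<close> at the time (L (y . e) - \<xi>) / c.\<close>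
    have "continuous_on UNIV (\<lambda>p. (\<lambda>(t, x). u t x) ((L * (snd p \<bullet> e) - fst p) / c, L *\<^sub>R snd p))"
      by (rule continuous_on_compose2[OF uc]) (use c in \<open>auto intro!: continuous_intros\<close>)
    then have cont': "continuous_on UNIV (\<lambda>(\<xi>, y). \<phi>' \<xi> y)"
      using c L by (simp add: u_def case_prod_unfold)
    obtain \<tau> \<sigma> where eq: "\<And>t x. t < 0 \<Longrightarrow>
        \<phi>' (x \<bullet> e - c * t + \<sigma>) (x /\<^sub>R L) = \<phi> (x \<bullet> e - c * t + \<sigma> - \<tau>) (x /\<^sub>R L)"
      using slide[OF cont'] by blast
    have "e \<noteq> 0" using e by auto
    then obtain i where i: "e $ i \<noteq> 0" by (auto simp: vec_eq_iff)
    \<comment> \<open>Moving \<open>y\<close> by one period along axis \<open>i\<close> changes by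
      \<open>q\<close> the time at which a given \<open>\<xi>\<close> is seen.\<close>
    define q where "q = L * e $ i / c"
    have q: "q \<noteq> 0" using i c L by (simp add: q_def)
    have "\<phi>' \<xi> y = \<phi> (\<xi> + (- \<tau>)) y" for \<xi> y
    proof -
      \<comment> \<open>The time at which \<open>(\<xi>, y)\<close> is seen from
        \<open>L *\<^sub>R y\<close> with offset \<open>\<sigma>\<close>. It may be positive, and
        periods are used to bring it below 0.\<close>
      define b where "b = (L * (y \<bullet> e) + \<sigma> - \<xi>) / c"
      obtain N where N: "b < real N * \<bar>q\<bar>" using reals_Archimedean3[of "\<bar>q\<bar>"] q by auto
      \<comment> \<open>An integer of sign opposite to \<open>q\<close>, so that
        \<open>m * q\<close> is \<open>N\<close> steps of size |q| back in time.\<close>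
      define m where "m = - sgn q * real N"
      define k where "k = (m *\<^sub>R axis i 1 :: real^'n)"
      have k: "\<forall>j. k $ j \<in> \<int>" by (auto simp: k_def m_def axis_def sgn_if)
      have "m * q = - (real N * \<bar>q\<bar>)" by (simp add: m_def sgn_if)
      then have neg: "b + m * q < 0" using N by simp
      define x where "x = L *\<^sub>R (y + k)"
      have "c * (b + m * q) = L * (y \<bullet> e) + \<sigma> - \<xi> + m * (L * e $ i)"
        using c by (simp add: b_def q_def field_simps)
      moreover have "x \<bullet> e = L * (y \<bullet> e) + m * (L * e $ i)"
        by (simp add: x_def k_def inner_add_left inner_axis' algebra_simps)
      ultimately have x: "x \<bullet> e - c * (b + m * q) + \<sigma> = \<xi>" by simp
      have "x /\<^sub>R L = y + k" using L by (simp add: x_def)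
      with eq[OF neg, of x, unfolded x] show ?thesis
        by (simp add: periodic_ZN_shift(2)[OF per(1) k] periodic_ZN_shift(2)[OF per(2) k])
    qed
    then show ?thesis by blast
  qed
  moreover have "\<exists>\<tau>0. \<forall>x. \<phi>' (x \<bullet> e) (x /\<^sub>R L) = \<phi> (x \<bullet> e + \<tau>0) (x /\<^sub>R L)"
    if c: "c = 0" and cont': "continuous_on UNIV (\<lambda>(\<xi>, y). \<phi>' \<xi> y)"
  proof -
    obtain \<tau> \<sigma> \<kappa> \<theta> where eq: "\<And>t x. t < 0 \<Longrightarrow>
        \<phi>' (x \<bullet> e - c * t + \<sigma>) (x /\<^sub>R L) = \<phi> (x \<bullet> e - c * t + \<sigma> - \<tau>) (x /\<^sub>R L)"
      and \<kappa>: "\<And>n i. \<kappa> n $ i \<in> \<int>" and lim: "(\<lambda>n. L * (\<kappa> n \<bullet> e) - c * \<theta> n) \<longlonglongrightarrow> \<sigma>"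
      using slide[OF cont'] by blast
    have "\<phi>' (x \<bullet> e) (x /\<^sub>R L) = \<phi> (x \<bullet> e + (- \<tau>)) (x /\<^sub>R L)" for x
    proof -
      \<comment> \<open>First frame coordinate of \<open>x - L *\<^sub>R \<kappa> n\<close> with
        offset \<open>\<sigma>\<close>; it tends to x . e because L (\<kappa> n . e) tends to
        \<open>\<sigma>\<close>.\<close>
      define s where "s n = x \<bullet> e - L * (\<kappa> n \<bullet> e) + \<sigma>" for n
      \<comment> \<open>For \<open>c = 0\<close> time drops out of the frame, so \<open>- 1\<close>
        stands for any negative time; periodicity then removes the lattice vector.\<close>
      have same: "\<phi>' (s n) (x /\<^sub>R L) = \<phi> (s n - \<tau>) (x /\<^sub>R L)" for n
      proof -
        have "(x - L *\<^sub>R \<kappa> n) /\<^sub>R L = x /\<^sub>R L - \<kappa> n" using L by (simp add: scaleR_diff_right)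
        then show ?thesis
          using eq[of "- 1" "x - L *\<^sub>R \<kappa> n"] \<kappa>
          by (simp add: c s_def inner_diff_left periodic_ZN_shift(1)[OF per(1)] periodic_ZN_shift(1)[OF per(2)])
      qed
      have "(\<lambda>n. x \<bullet> e - L * (\<kappa> n \<bullet> e) + \<sigma>) \<longlonglongrightarrow> x \<bullet> e - \<sigma> + \<sigma>"
        using lim c by (intro tendsto_intros) simp
      then have slim: "s \<longlonglongrightarrow> x \<bullet> e" by (simp add: s_def[abs_def])
      have "(\<lambda>n. (\<lambda>(\<xi>, y). \<phi>' \<xi> y) (s n, x /\<^sub>R L)) \<longlonglongrightarrow> (\<lambda>(\<xi>, y). \<phi>' \<xi> y) (x \<bullet> e, x /\<^sub>R L)"
        by (rule continuous_on_tendsto_compose[OF cont']) (auto intro!: tendsto_intros slim)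
      moreover have "(\<lambda>n. (\<lambda>(\<xi>, y). \<phi> \<xi> y) (s n - \<tau>, x /\<^sub>R L)) \<longlonglongrightarrow> (\<lambda>(\<xi>, y). \<phi> \<xi> y) (x \<bullet> e - \<tau>, x /\<^sub>R L)"
        by (rule continuous_on_tendsto_compose[OF cont]) (auto intro!: tendsto_intros slim)
      ultimately show ?thesis using LIMSEQ_unique by (simp add: same)
    qed
    then show ?thesis by blast
  qed
  ultimately show ?thesis using c' by blast
qed

end
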